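(* Let $D\subset\mathbb C^n$ be a domain such that $\limsup_{D\ni z\to a}K_D(z)=\infty$ for every $a\in\partial D$. Assume that at least one of the following conditions is satisfied: (1) the envelope of holomorphy $\hat D$ of $D$ is a domain in $\mathbb C^n$; (2) for every $a\in\partial D$ and every neighborhood $U_a$ of $a$ there is a neighborhood $V_a\subset U_a$ of $a$ such that $V_a\cap D$ is connected (this is the case, for example, when $D$ is a $C^1$-smooth domain). Then $D$ is pseudoconvex.
   Context: A domain is a connected open set. For a domain $D\subset\mathbb C^n$, $L_h^2(D):=L^2(D)\cap\mathcal O(D)$ is the space of square-integrable (with respect to Lebesgue measure) holomorphic functions on $D$, and $K_D(z)$ denotes the Bergman kernel of $D$ on the diagonal, $K_D(z)=\sup\{|f(z)|^2: f\in L_h^2(D),\ \|f\|_{L^2(D)}\le 1\}$. The envelope of holomorphy $\hat D$ of $D$ is in general a Riemann domain spread over $\mathbb C^n$; condition (1) says that it is schlicht, i.e. that it can be realized as a domain $\hat D\subset\mathbb C^n$ containing $D$. *)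

theory Defs
  imports "HOL-Analysis.Analysis"
begin

definition cdomain :: "(complex ^ 'n) set \<Rightarrow> bool" where
  "cdomain D \<longleftrightarrow> open D \<and> connected D"

definition holomorphic_Cn :: "(complex ^ 'n) set \<Rightarrow> (complex ^ 'n \<Rightarrow> complex) \<Rightarrow> bool" where
  "holomorphic_Cn D f \<longleftrightarrow>
     (\<forall>z\<in>D. \<exists>f'. (f has_derivative f') (at z within D) \<and> (\<forall>c v. f' (c *s v) = c * f' v))"

subsection \<open>The Bergman kernel\<close>

definition L2h :: "(complex ^ 'n) set \<Rightarrow> (complex ^ 'n \<Rightarrow> complex) set" where
  "L2h D = {f. holomorphic_Cn D f \<and> set_integrable lebesgue D (\<lambda>z. (cmod (f z))\<^sup>2)}"

definition L2_norm_on :: "(complex ^ 'n) set \<Rightarrow> (complex ^ 'n \<Rightarrow> complex) \<Rightarrow> real" where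
  "L2_norm_on D f = sqrt (set_lebesgue_integral lebesgue D (\<lambda>z. (cmod (f z))\<^sup>2))"

(* Valued in ennreal, so that the supremum and the upper limit at the boundary are unconditional. *)
definition bergman_kernel :: "(complex ^ 'n) set \<Rightarrow> complex ^ 'n \<Rightarrow> ennreal" where
  "bergman_kernel D z = (SUP f\<in>{f \<in> L2h D. L2_norm_on D f \<le> 1}. ennreal ((cmod (f z))\<^sup>2))"

subsection \<open>Pseudoconvexity\<close>

(* For continuous real-valued functions: the sub-mean value inequality on every closed
   complex disc contained in D. *)
definition continuous_psh_on :: "(complex ^ 'n) set \<Rightarrow> (complex ^ 'n \<Rightarrow> real) \<Rightarrow> bool" where
  "continuous_psh_on D u \<longleftrightarrow> continuous_on D u \<and>
     (\<forall>z w. (\<forall>t. cmod t \<le> 1 \<longrightarrow> z + t *s w \<in> D) \<longrightarrow>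
        u z \<le> 1 / (2 * pi) * integral {0..2 * pi} (\<lambda>\<theta>. u (z + cis \<theta> *s w)))"

(* Existence of a continuous plurisubharmonic exhaustion function. *)
definition pseudoconvex :: "(complex ^ 'n) set \<Rightarrow> bool" where
  "pseudoconvex D \<longleftrightarrow> open D \<and>
     (\<exists>u. continuous_psh_on D u \<and>
        (\<forall>c. compact (closure {z \<in> D. u z < c}) \<and> closure {z \<in> D. u z < c} \<subseteq> D))"

subsection \<open>Riemann domains and the envelope of holomorphy\<close>

definition riemann_chart ::
    "'x topology \<Rightarrow> ('x \<Rightarrow> complex ^ 'n) \<Rightarrow> 'x set \<Rightarrow> bool" where
  "riemann_chart X p U \<longleftrightarrow> openin X U \<and> open (p ` U) \<and>
     homeomorphic_map (subtopology X U) (top_of_set (p ` U)) p"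

definition riemann_domain :: "'x topology \<Rightarrow> ('x \<Rightarrow> complex ^ 'n) \<Rightarrow> bool" where
  "riemann_domain X p \<longleftrightarrow> connected_space X \<and> Hausdorff_space X \<and>
     (\<forall>x\<in>topspace X. \<exists>U. x \<in> U \<and> riemann_chart X p U)"

definition riemann_morphism ::
    "'x topology \<Rightarrow> ('x \<Rightarrow> complex ^ 'n) \<Rightarrow> 'y topology \<Rightarrow> ('y \<Rightarrow> complex ^ 'n) \<Rightarrow> ('x \<Rightarrow> 'y) \<Rightarrow> bool" where
  "riemann_morphism X p Y q \<phi> \<longleftrightarrow> continuous_map X Y \<phi> \<and> (\<forall>x\<in>topspace X. q (\<phi> x) = p x)"

definition riemann_holomorphic ::
    "'x topology \<Rightarrow> ('x \<Rightarrow> complex ^ 'n) \<Rightarrow> ('x \<Rightarrow> complex) \<Rightarrow> bool" where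
  "riemann_holomorphic X p F \<longleftrightarrow>
     (\<forall>x\<in>topspace X. \<exists>U g. x \<in> U \<and> riemann_chart X p U \<and>
        holomorphic_Cn (p ` U) g \<and> (\<forall>y\<in>U. F y = g (p y)))"

definition holomorphic_extension ::
    "(complex ^ 'n) set \<Rightarrow> 'x topology \<Rightarrow> ('x \<Rightarrow> complex ^ 'n) \<Rightarrow> (complex ^ 'n \<Rightarrow> 'x) \<Rightarrow> bool" where
  "holomorphic_extension D X p \<alpha> \<longleftrightarrow> riemann_domain X p \<and>
     riemann_morphism (top_of_set D) id X p \<alpha> \<and>
     (\<forall>f. holomorphic_Cn D f \<longrightarrow>
        (\<exists>F. riemann_holomorphic X p F \<and> (\<forall>z\<in>D. F (\<alpha> z) = f z)))"

(* The envelope of holomorphy is the maximal holomorphic extension. The competing extensions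
   have points of type "(complex ^ 'n) * nat"; this is no restriction, since by
   Poincare-Volterra a connected Riemann domain has countable fibres, so every one of them
   is isomorphic to a Riemann domain whose points are of that type. *)
definition envelope_of_holomorphy ::
    "(complex ^ 'n) set \<Rightarrow> 'x topology \<Rightarrow> ('x \<Rightarrow> complex ^ 'n) \<Rightarrow> (complex ^ 'n \<Rightarrow> 'x) \<Rightarrow> bool" where
  "envelope_of_holomorphy D X p \<alpha> \<longleftrightarrow> holomorphic_extension D X p \<alpha> \<and>
     (\<forall>(Y :: ((complex ^ 'n) \<times> nat) topology) q \<beta>. holomorphic_extension D Y q \<beta> \<longrightarrow>
        (\<exists>\<phi>. riemann_morphism Y q X p \<phi> \<and> (\<forall>z\<in>D. \<phi> (\<beta> z) = \<alpha> z)))"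

definition schlicht_envelope :: "(complex ^ 'n) set \<Rightarrow> (complex ^ 'n) set \<Rightarrow> bool" where
  "schlicht_envelope D E \<longleftrightarrow> cdomain E \<and> D \<subseteq> E \<and> envelope_of_holomorphy D (top_of_set E) id id"

subsection \<open>Boundary conditions\<close>

definition locally_connected_at_boundary :: "(complex ^ 'n) set \<Rightarrow> bool" where
  "locally_connected_at_boundary D \<longleftrightarrow>
     (\<forall>a\<in>frontier D. \<forall>U. open U \<and> a \<in> U \<longrightarrow>
        (\<exists>V. open V \<and> a \<in> V \<and> V \<subseteq> U \<and> connected (V \<inter> D)))"

(* Local C^1 defining functions r with gradient g with respect to the real inner product. *)
definition C1_smooth :: "(complex ^ 'n) set \<Rightarrow> bool" where
  "C1_smooth D \<longleftrightarrow>
     (\<forall>a\<in>frontier D. \<exists>U r g. open U \<and> a \<in> U \<and>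
        (\<forall>x\<in>U. (r has_derivative (\<lambda>h. g x \<bullet> h)) (at x)) \<and> continuous_on U g \<and>
        (\<forall>x\<in>U. g x \<noteq> 0) \<and> D \<inter> U = {x \<in> U. r x < (0 :: real)})"

end

theory Submission
  imports Defs "HOL-Complex_Analysis.Complex_Analysis" "HOL-Real_Asymp.Real_Asymp"
begin

text \<open>
Let \<open>\<delta>\<close> be the distance to the complement of \<open>D\<close>. The exhaustion function is the maximum of the norm
and \<open>- ln \<delta>\<close>, and the point is the sub-mean value inequality for \<open>- ln \<delta>\<close> on a closed complex disc
\<open>z + t *s w\<close> in \<open>D\<close>.

Suppose that it fails. Then the geometric mean of \<open>\<delta>\<close> over the boundary circle of the disc is larger
than \<open>\<delta> z\<close>. For each holomorphic function \<open>u\<close> on \<open>D\<close>, the Taylor coefficients of \<open>u\<close> in a fixed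
direction are holomorphic in the base point, and on the circle they satisfy the Cauchy
inequalities with radius almost \<open>\<delta>\<close>. The sub-mean value property of the logarithm of a holomorphic
function (\<open>Jensen_circle_bound\<close>) transfers these inequalities to the centre, with the geometric mean
as radius. Hence the Taylor series of \<open>u\<close> at \<open>z\<close> converges in a ball \<open>B\<close> of radius larger than \<open>\<delta> z\<close>, with
a bound that only involves the maximum of \<open>\<bar>u\<bar>\<close> on a compact subset of \<open>D\<close> independent of \<open>u\<close>
(\<open>extension_to_mean_radius_ball\<close>). On the unit ball of \<open>L2h D\<close> that maximum is bounded
(\<open>L2h_unit_ball_bounded_on_compact\<close>), by the mean value property and the invariance of Lebesgue
measure under multiplication by \<open>cis \<theta>\<close>.

Let \<open>a\<close> be a boundary point of \<open>D\<close> at distance \<open>\<delta> z\<close> from \<open>z\<close>. It lies in \<open>B\<close>. If the extension of each \<open>u\<close>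
agrees with \<open>u\<close> on all points of \<open>D\<close> near \<open>a\<close>, then the Bergman kernel is bounded near \<open>a\<close>,
a contradiction. Agreement is clear on the component of \<open>D \<inter> B\<close> that contains \<open>z\<close>, but \<open>D\<close> may return to
\<open>a\<close> from another side. Each of the two alternative hypotheses excludes this: local connectedness at \<open>a\<close>
directly, and a schlicht envelope of holomorphy \<open>E\<close> because \<open>D\<close> with \<open>B\<close> glued to it along
that component is a Riemann domain to which all functions extend. By maximality it maps to \<open>E\<close>, so
\<open>B \<subseteq> E\<close>, and each \<open>u\<close> has a single-valued extension to \<open>E\<close> (\<open>extension_agrees_if_schlicht\<close>).
\<close>

section \<open>Holomorphy along complex lines\<close>

lemma norm_vector_scalar_mult [simp]: "norm (c *s (v :: complex ^ 'n)) = cmod c * norm v"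
  by (simp add: norm_vec_def norm_mult L2_set_right_distrib)

lemma bounded_linear_vector_scalar_mult_left: "bounded_linear (\<lambda>s. s *s (v :: complex ^ 'n))"
  by (rule bounded_linear_intro[where K = "norm v"])
     (auto simp: vec_eq_iff algebra_simps)

lemmas has_derivative_vector_scalar_mult_left [derivative_intros] =
  bounded_linear.has_derivative[OF bounded_linear_vector_scalar_mult_left]
lemmas continuous_on_vector_scalar_mult_left [continuous_intros] =
  bounded_linear.continuous_on[OF bounded_linear_vector_scalar_mult_left]

lemma open_complex_line_preimage:
  fixes p v :: "complex ^ 'n"
  assumes "open D"
  shows "open {s. p + s *s v \<in> D}"
  using open_vimage[OF assms, of "\<lambda>s. p + s *s v"]
  by (simp add: vimage_def continuous_on_add continuous_on_vector_scalar_mult_left)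

lemma holomorphic_Cn_line:
  fixes p v :: "complex ^ 'n"
  assumes f: "holomorphic_Cn D f" and D: "open D"
  shows "(\<lambda>s. f (p + s *s v)) holomorphic_on {s. p + s *s v \<in> D}"
proof (rule holomorphic_onI)
  fix s assume "s \<in> {s. p + s *s v \<in> D}"
  then have sD: "p + s *s v \<in> D" by simp
  with f obtain f' where f': "(f has_derivative f') (at (p + s *s v) within D)"
    and lin: "\<forall>c v. f' (c *s v) = c * f' v"
    unfolding holomorphic_Cn_def by blast
  have "(f has_derivative f') (at (p + s *s v))"
    using f' at_within_open[OF sD D] by simp
  moreover have "((\<lambda>s. p + s *s v) has_derivative (\<lambda>h. h *s v)) (at s)"
    using has_derivative_add[OF has_derivative_const
        has_derivative_vector_scalar_mult_left[OF has_derivative_ident], of p] by simp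
  ultimately have "((\<lambda>s. f (p + s *s v)) has_derivative (\<lambda>h. f' (h *s v))) (at s)"
    by (rule has_derivative_compose[rotated])
  then have "((\<lambda>s. f (p + s *s v)) has_field_derivative f' v) (at s)"
    by (simp add: lin has_field_derivative_def mult_commute_abs)
  then show "(\<lambda>s. f (p + s *s v)) field_differentiable at s within {s. p + s *s v \<in> D}"
    using field_differentiable_at_within field_differentiable_def by blast
qed

text \<open>The error is quadratic with a constant that depends on \<open>f\<close> only through \<open>M\<close> and \<open>r\<close>. This
uniformity is what turns statements about single complex lines into statements about all
directions at once.\<close>

lemma first_order_Taylor_bound:
  assumes f: "f holomorphic_on ball x r" and r: "r > 0"
    and M: "\<And>y. y \<in> ball x r \<Longrightarrow> cmod (f y) \<le> M" and h: "cmod h < r / 2"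
  shows "cmod (f (x + h) - f x - h * deriv f x) \<le> 32 * M / r\<^sup>2 * (cmod h)\<^sup>2"
proof -
  define S where "S = ball x (r / 2)"
  have sub: "S \<subseteq> ball x r" using r by (auto simp: S_def)
  have "cmod ((deriv ^^ 0) f (x + h) - (\<Sum>i\<le>1. (deriv ^^ i) f x * ((x + h) - x) ^ i / fact i))
      \<le> (32 * M / r\<^sup>2) * cmod ((x + h) - x) ^ Suc 1 / fact 1"
  proof (rule complex_Taylor[where S = S])
    show "convex S" by (simp add: S_def)
    show "x \<in> S" "x + h \<in> S" using r h by (simp_all add: S_def dist_norm)
  next
    fix i y assume "y \<in> S" "i \<le> (1::nat)"
    then have "y \<in> ball x r" using sub by blast
    from has_field_derivative_higher_deriv[OF f open_ball this]
    show "((deriv ^^ i) f has_field_derivative (deriv ^^ Suc i) f y) (at y within S)"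
      by (rule has_field_derivative_at_within)
  next
    fix y assume y: "y \<in> S"
    have sub2: "cball y (r/4) \<subseteq> ball x r"
    proof
      fix w assume "w \<in> cball y (r/4)"
      then show "w \<in> ball x r"
        using y r dist_triangle[of x w y] by (simp add: S_def)
    qed
    \<comment> \<open>Any radius below \<open>r / 2\<close> would do for the Cauchy estimate; \<open>r / 4\<close> gives the constant 32.\<close>
    have "cmod ((deriv ^^ 2) f y) \<le> fact 2 * M / (r/4) ^ 2"
    proof (rule Cauchy_inequality)
      show "f holomorphic_on ball y (r/4)"
        using sub2 f ball_subset_cball holomorphic_on_subset by blast
      show "continuous_on (cball y (r/4)) f"
        using sub2 f holomorphic_on_imp_continuous_on holomorphic_on_subset by blast
      show "0 < r/4" using r by simp
      show "cmod (f w) \<le> M" if "cmod (y - w) = r/4" for w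
      proof -
        have "w \<in> cball y (r/4)" using that by (simp add: dist_norm)
        then show ?thesis using M sub2 by blast
      qed
    qed
    then show "cmod ((deriv ^^ Suc 1) f y) \<le> 32 * M / r\<^sup>2"
      by (simp add: numeral_2_eq_2 power2_eq_square)
  qed
  then show ?thesis by (simp add: algebra_simps power2_eq_square)
qed

text \<open>Gateaux holomorphy. It is all that is visible when a function of several variables is studied
through restrictions to complex lines, and it passes to locally uniform limits by the
one-variable theorem.\<close>

definition holomorphic_on_lines :: "(complex ^ 'n) set \<Rightarrow> (complex ^ 'n \<Rightarrow> complex) \<Rightarrow> bool" where
  "holomorphic_on_lines D g \<longleftrightarrow> (\<forall>p v. (\<lambda>s. g (p + s *s v)) holomorphic_on {s. p + s *s v \<in> D})"

text \<open>On each line through \<open>x\<close> the first-order Taylor error is at most a fixed multiple of the square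
of the distance, by \<open>first_order_Taylor_bound\<close>; so the directional derivatives at \<open>x\<close> form the
Frechet derivative as soon as they are additive. Additivity comes from comparing the value of
\<open>g\<close> at the midpoint of \<open>x + a\<close> and \<open>x + b\<close> with the values at these two points: the midpoint rule
holds along the line that joins them, up to a quadratic error, and scaling kills that error.\<close>

lemma holomorphic_on_lines_imp_holomorphic_Cn:
  fixes g :: "complex ^ 'n \<Rightarrow> complex"
  assumes D: "open D" and g: "holomorphic_on_lines D g"
    and bdd: "\<And>x. x \<in> D \<Longrightarrow> \<exists>r>0. \<exists>M. ball x r \<subseteq> D \<and> (\<forall>y\<in>ball x r. cmod (g y) \<le> M)"
  shows "holomorphic_Cn D g"
  unfolding holomorphic_Cn_def
proof
  fix x assume "x \<in> D"
  then obtain r M where r: "r > 0" and sub: "ball x r \<subseteq> D" and M: "\<And>y. y \<in> ball x r \<Longrightarrow> cmod (g y) \<le> M"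
    using bdd by blast
  have M0: "M \<ge> 0" using M[of x] r norm_ge_zero[of "g x"] by (simp del: norm_ge_zero)
  define d where "d y h = deriv (\<lambda>s. g (y + s *s h)) 0" for y h
  define C where "C = 128 * M / r\<^sup>2"
  have C0: "C \<ge> 0" using M0 by (simp add: C_def)
  have inball: "y + w \<in> ball x r" if "y \<in> ball x (r/2)" "norm w < r/2" for y w
    using that norm_triangle_ineq[of "y - x" w] by (simp add: dist_norm norm_minus_commute algebra_simps)
  have E1: "cmod (g (y + h) - g y - d y h) \<le> C * (norm h)\<^sup>2"
    if y: "y \<in> ball x (r/2)" and h: "norm h < r / 4" for y h
  proof (cases "h = 0")
    case True then show ?thesis by (simp add: d_def)
  next
    case False
    \<comment> \<open>The line through \<open>y\<close> is parametrised by \<open>y + s *s h\<close>, so that \<open>s = 1\<close> is the step to \<open>y + h\<close>;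
       \<open>R\<close> is the radius \<open>r / 2\<close> in this parameter.\<close>
    define R where "R = r / (2 * norm h)"
    have R: "R > 0" "1 < R / 2" using False r h by (simp_all add: R_def field_simps)
    have line: "y + s *s h \<in> ball x r" if "s \<in> ball 0 R" for s
      using that False by (intro inball[OF y]) (simp add: R_def field_simps)
    have "cmod (g (y + (0 + 1) *s h) - g (y + 0 *s h) - 1 * deriv (\<lambda>s. g (y + s *s h)) 0)
        \<le> 32 * M / R\<^sup>2 * (cmod 1)\<^sup>2"
    proof (rule first_order_Taylor_bound[where f = "\<lambda>s. g (y + s *s h)"])
      show "(\<lambda>s. g (y + s *s h)) holomorphic_on ball 0 R"
        using g line sub unfolding holomorphic_on_lines_def
        by (blast intro: holomorphic_on_subset)
      show "cmod (g (y + s *s h)) \<le> M" if "s \<in> ball 0 R" for s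
        using M line[OF that] by blast
    qed (use R in auto)
    also have "32 * M / R\<^sup>2 * (cmod 1)\<^sup>2 = C * (norm h)\<^sup>2"
      using False r by (simp add: R_def C_def field_simps power2_eq_square)
    finally show ?thesis by (simp add: d_def)
  qed
  have hom: "d y (c *s h) = c * d y h" if "y \<in> D" for y c h
  proof -
    have "(\<lambda>s. g (y + s *s h)) field_differentiable at 0"
      using g that unfolding holomorphic_on_lines_def
      by (intro holomorphic_on_imp_differentiable_at[where s="{s. y + s *s h \<in> D}"]
            open_complex_line_preimage D) auto
    then have "((\<lambda>s. g (y + s *s h)) has_field_derivative d y h) (at (0 * c))"
      unfolding d_def by (simp add: field_differentiable_derivI)
    moreover have "((\<lambda>s. s * c) has_field_derivative c) (at 0)"
      using DERIV_cmult_right[OF DERIV_ident, of c] by simp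
    ultimately have "(((\<lambda>s. g (y + s *s h)) \<circ> (\<lambda>s. s * c)) has_field_derivative d y h * c) (at 0)"
      by (rule DERIV_chain)
    then show ?thesis unfolding d_def by (simp add: DERIV_imp_deriv o_def mult.commute)
  qed
  define Q where "Q = d x"
  have xb: "x \<in> ball x (r/2)" using r by simp
  have add: "Q (a + b) = Q a + Q b" for a b
  proof -
    define m where "m = (1/2) *s (a + b)"
    define k where "k = (1/2) *s (a - b)"
    have half: "a = m + k" "b = m - k"
      by (simp_all add: m_def k_def vec_eq_iff ring_distribs)
    have "Q m = (1/2) * Q (a + b)" unfolding m_def Q_def by (rule hom[OF \<open>x \<in> D\<close>])
    then have "2 * Q m = Q (a + b)" by (simp only: mult.assoc[symmetric]) simp
    then have m2: "Q (a + b) = 2 * Q m" by (rule sym)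
    define K where "K = C * ((norm a)\<^sup>2 + (norm b)\<^sup>2 + 2 * (norm m)\<^sup>2 + 2 * (norm k)\<^sup>2)"
    \<comment> \<open>An upper bound for the four norms; the summand 1 makes it positive.\<close>
    define N where "N = 1 + norm a + norm b + norm m + norm k"
    have N: "N > 0" unfolding N_def by (intro add_pos_nonneg) auto
    define e where "e = r / (4 * N)"
    have e: "e > 0" using r N by (simp add: e_def)
    have main: "t * cmod (Q a + Q b - Q (a + b)) \<le> t\<^sup>2 * K" if t: "0 < t" "t < e" for t :: real
    proof -
      define c where "c = complex_of_real t"
      have small: "norm (c *s w) < r / 4" if "norm w \<le> N" for w :: "complex ^ 'n"
      proof -
        have "norm (c *s w) \<le> t * N"
          using that t by (simp add: c_def)
        also have "\<dots> < e * N" using t N by (intro mult_strict_right_mono) auto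
        also have "\<dots> = r / 4" using N by (simp add: e_def)
        finally show ?thesis .
      qed
      have sa: "norm (c *s a) < r / 4" and sb: "norm (c *s b) < r / 4"
        and sm: "norm (c *s m) < r / 4" and sk: "norm (c *s k) < r / 4"
        by (intro small, simp add: N_def)+
      define y where "y = x + c *s m"
      have y: "y \<in> ball x (r/2)" using sm r by (simp add: y_def dist_norm)
      then have yD: "y \<in> D" using sub r by auto
      have n2: "(norm (c *s w))\<^sup>2 = t\<^sup>2 * (norm w)\<^sup>2" for w :: "complex ^ 'n"
        using t by (simp add: c_def power_mult_distrib)
      have ca: "x + c *s a = y + c *s k" "x + c *s b = y + - (c *s k)"
        by (simp_all add: half y_def vec_eq_iff algebra_simps)
      define dk where "dk = d y (c *s k)"
      have neg: "d y (- (c *s k)) = - dk"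
        using hom[OF yD, of "-1" "c *s k"] by (simp add: dk_def scalar_mult_eq_scaleR[symmetric] vector_sneg_minus1[symmetric])
      have 1: "cmod (g (x + c *s a) - g x - c * Q a) \<le> C * (t\<^sup>2 * (norm a)\<^sup>2)"
        using E1[OF xb sa] unfolding n2 by (simp add: Q_def hom[OF \<open>x \<in> D\<close>])
      have 2: "cmod (g (x + c *s b) - g x - c * Q b) \<le> C * (t\<^sup>2 * (norm b)\<^sup>2)"
        using E1[OF xb sb] unfolding n2 by (simp add: Q_def hom[OF \<open>x \<in> D\<close>])
      have 3: "cmod (g y - g x - c * Q m) \<le> C * (t\<^sup>2 * (norm m)\<^sup>2)"
        using E1[OF xb sm] unfolding n2 by (simp add: Q_def hom[OF \<open>x \<in> D\<close>] y_def)
      have 4: "cmod (g (x + c *s a) - g y - dk) \<le> C * (t\<^sup>2 * (norm k)\<^sup>2)"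
        using E1[OF y sk] unfolding n2 ca by (simp add: dk_def)
      have 5: "cmod (g (x + c *s b) - g y + dk) \<le> C * (t\<^sup>2 * (norm k)\<^sup>2)"
        using E1[OF y, of "- (c *s k)"] sk unfolding norm_minus_cancel n2 ca by (simp add: neg)
      have "c * (Q a + Q b - Q (a + b)) =
          (g (x + c *s a) - g y - dk) + (g (x + c *s b) - g y + dk)
          + (g y - g x - c * Q m) + (g y - g x - c * Q m)
          + - (g (x + c *s a) - g x - c * Q a) + - (g (x + c *s b) - g x - c * Q b)"
        unfolding m2 by (simp add: algebra_simps)
      also have "cmod \<dots> \<le> C * (t\<^sup>2 * (norm k)\<^sup>2) + C * (t\<^sup>2 * (norm k)\<^sup>2) + C * (t\<^sup>2 * (norm m)\<^sup>2)
          + C * (t\<^sup>2 * (norm m)\<^sup>2) + C * (t\<^sup>2 * (norm a)\<^sup>2) + C * (t\<^sup>2 * (norm b)\<^sup>2)"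
        by (intro norm_triangle_mono 3 4 5 1[THEN eq_refl[OF norm_minus_cancel, THEN order_trans]]
            2[THEN eq_refl[OF norm_minus_cancel, THEN order_trans]])
      also have "\<dots> = t\<^sup>2 * K" by (simp add: K_def algebra_simps)
      finally show ?thesis using t by (simp add: c_def norm_mult)
    qed
    have le: "cmod (Q a + Q b - Q (a + b)) \<le> t * K" if "0 < t" "t < e" for t :: real
      using main[OF that] that by (simp add: power2_eq_square)
    have "eventually (\<lambda>t. cmod (Q a + Q b - Q (a + b)) \<le> t * K) (at_right 0)"
      using e le by (intro eventually_at_rightI[of 0 e]) auto
    moreover have "((\<lambda>t. t * K) \<longlongrightarrow> 0 * K) (at_right 0)" by (intro tendsto_intros)
    ultimately have "cmod (Q a + Q b - Q (a + b)) \<le> 0 * K"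
      by (intro tendsto_lowerbound[of "\<lambda>t. t * K"]) auto
    then show ?thesis by simp
  qed
  have Qc: "Q (c *s v) = c * Q v" for c v by (simp add: Q_def hom \<open>x \<in> D\<close>)
  have "linear Q"
  proof (rule linearI)
    fix c :: real and v
    show "Q (c *\<^sub>R v) = c *\<^sub>R Q v"
      using Qc[of "of_real c" v] by (simp add: scaleR_conv_of_real[symmetric] vec_eq_iff
          vector_scalar_mult_def scaleR_vec_def)
  qed (rule add)
  then have "bounded_linear Q" by (simp add: linear_conv_bounded_linear)
  moreover have "\<exists>e'>0. \<forall>y\<in>D. norm (y - x) < e' \<longrightarrow> norm (g y - g x - Q (y - x)) \<le> e * norm (y - x)"
    if e: "e > 0" for e
  proof (intro exI[of _ "min (r/4) (e / (C + 1))"] conjI ballI impI)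
    show "0 < min (r/4) (e / (C + 1))" using r e C0 by simp
    fix y assume y: "norm (y - x) < min (r/4) (e / (C + 1))"
    have "norm (g y - g x - Q (y - x)) \<le> C * (norm (y - x))\<^sup>2"
      using E1[OF xb, of "y - x"] y by (simp add: Q_def)
    also have "\<dots> = C * norm (y - x) * norm (y - x)" by (simp add: power2_eq_square)
    also have "\<dots> \<le> e * norm (y - x)"
    proof (rule mult_right_mono)
      have "C * norm (y - x) \<le> (C + 1) * norm (y - x)" by (simp add: mult_right_mono)
      also have "\<dots> \<le> e" using y C0 by (simp add: field_simps)
      finally show "C * norm (y - x) \<le> e" .
    qed simp
    finally show "norm (g y - g x - Q (y - x)) \<le> e * norm (y - x)" .
  qed
  ultimately have "(g has_derivative Q) (at x within D)"
    by (simp add: has_derivative_within_alt)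
  with Qc show "\<exists>f'. (g has_derivative f') (at x within D) \<and> (\<forall>c v. f' (c *s v) = c * f' v)"
    by blast
qed

lemma holomorphic_Cn_imp_holomorphic_on_lines:
  "holomorphic_Cn D g \<Longrightarrow> open D \<Longrightarrow> holomorphic_on_lines D g"
  by (simp add: holomorphic_on_lines_def holomorphic_Cn_line)

lemma holomorphic_on_lines_subset:
  "holomorphic_on_lines D g \<Longrightarrow> D' \<subseteq> D \<Longrightarrow> holomorphic_on_lines D' g"
  unfolding holomorphic_on_lines_def by (blast intro: holomorphic_on_subset)

lemma holomorphic_Cn_continuous_on: "holomorphic_Cn D g \<Longrightarrow> continuous_on D g"
  unfolding holomorphic_Cn_def continuous_on_eq_continuous_within
  using has_derivative_continuous by blast

text \<open>A ball in \<open>D\<close> that meets the interior of the coincidence set lies in it, because each point of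
the ball is joined to an interior point of coincidence by a complex line, on which the
one-variable identity theorem applies. So that interior is both open and closed in \<open>D\<close>.\<close>

lemma identity_on_lines:
  fixes f g :: "complex ^ 'n \<Rightarrow> complex"
  assumes D: "open D" "connected D" and f: "holomorphic_on_lines D f" and g: "holomorphic_on_lines D g"
    and U: "open U" "U \<noteq> {}" "U \<subseteq> D" "\<And>x. x \<in> U \<Longrightarrow> f x = g x" and x: "x \<in> D"
  shows "f x = g x"
proof -
  define Z where "Z = interior {x \<in> D. f x = g x}"
  have ZD: "Z \<subseteq> D" and Zeq: "\<And>y. y \<in> Z \<Longrightarrow> f y = g y"
    using interior_subset by (auto simp: Z_def)
  have ball_in_Z: "ball p r \<subseteq> Z" if p: "ball p r \<subseteq> D" "q \<in> ball p r" "q \<in> Z" for p q r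
    unfolding Z_def
  proof (rule interior_maximal)
    show "ball p r \<subseteq> {x \<in> D. f x = g x}"
    proof
      fix y assume y: "y \<in> ball p r"
      define S where "S = {s. q + s *s (y - q) \<in> ball p r}"
      define T where "T = {s. q + s *s (y - q) \<in> Z \<inter> ball p r}"
      have oS: "open S" and oT: "open T"
        unfolding S_def T_def Z_def
        by (intro open_complex_line_preimage open_Int open_interior open_ball)+
      have "convex S"
      proof (rule convexI)
        fix s t and u v :: real assume st: "s \<in> S" "t \<in> S" and uv: "0 \<le> u" "0 \<le> v" "u + v = 1"
        have "u *\<^sub>R (q + s *s (y - q)) + v *\<^sub>R (q + t *s (y - q)) \<in> ball p r"
          using st uv convexD[OF convex_ball] by (simp add: S_def)
        also have "u *\<^sub>R (q + s *s (y - q)) + v *\<^sub>R (q + t *s (y - q))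
            = (u + v) *\<^sub>R q + (u *\<^sub>R s + v *\<^sub>R t) *s (y - q)"
          by (simp add: vec_eq_iff algebra_simps)
        finally show "u *\<^sub>R s + v *\<^sub>R t \<in> S" by (simp add: S_def uv)
      qed
      have hol: "(\<lambda>s. h (q + s *s (y - q))) holomorphic_on S" if "holomorphic_on_lines D h" for h
        using that p(1) unfolding holomorphic_on_lines_def S_def by (blast intro: holomorphic_on_subset)
      have "f (q + 1 *s (y - q)) = g (q + 1 *s (y - q))"
      proof (rule analytic_continuation_open[of T S "\<lambda>s. f (q + s *s (y - q))" "\<lambda>s. g (q + s *s (y - q))"])
        show "T \<noteq> {}" using p by (auto simp: T_def intro!: exI[of _ 0])
        show "T \<subseteq> S" by (auto simp: S_def T_def)
        show "connected S" using \<open>convex S\<close> by (rule convex_connected)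
        show "1 \<in> S" using y by (simp add: S_def)
        show "f (q + s *s (y - q)) = g (q + s *s (y - q))" if "s \<in> T" for s
          using that by (intro Zeq) (auto simp: T_def)
      qed (use oS oT hol f g in auto)
      then show "y \<in> {x \<in> D. f x = g x}" using y p by auto
    qed
  qed simp
  have "\<exists>e>0. ball y e \<subseteq> D - Z" if y: "y \<in> D - Z" for y
  proof -
    obtain e where e: "e > 0" "ball y e \<subseteq> D"
      using D(1) y unfolding open_contains_ball by blast
    have "ball y e \<inter> Z = {}"
    proof (rule ccontr)
      assume "ball y e \<inter> Z \<noteq> {}"
      then obtain q where "q \<in> ball y e" "q \<in> Z" by blast
      then have "ball y e \<subseteq> Z" by (intro ball_in_Z[OF e(2)])
      moreover have "y \<in> ball y e" using e by simp
      ultimately show False using y by blast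
    qed
    then show ?thesis using e by blast
  qed
  then have "open (D - Z)"
    unfolding open_contains_ball by (rule ballI)
  moreover have "open Z" by (simp add: Z_def)
  moreover have "U \<subseteq> Z" unfolding Z_def using U by (intro interior_maximal) auto
  ultimately have "D - Z = {}"
    using connectedD[OF D(2), of Z "D - Z"] U ZD by blast
  then show ?thesis using x Zeq by blast
qed

section \<open>Taylor coefficients that depend on a parameter\<close>

text \<open>Difference quotients are holomorphic in the parameter and converge uniformly in it, because the
Taylor error is controlled by the common bound \<open>M\<close>.\<close>

lemma holomorphic_higher_deriv_parameter:
  fixes \<Phi> :: "complex \<Rightarrow> complex \<Rightarrow> complex"
  assumes S: "open S"
    and hol: "\<And>s. s \<in> S \<Longrightarrow> \<Phi> s holomorphic_on ball 0 r"
    and par: "\<And>\<xi>. \<xi> \<in> ball 0 r \<Longrightarrow> (\<lambda>s. \<Phi> s \<xi>) holomorphic_on S"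
    and bdd: "\<And>s \<xi>. s \<in> S \<Longrightarrow> \<xi> \<in> ball 0 r \<Longrightarrow> cmod (\<Phi> s \<xi>) \<le> M"
    and x: "x \<in> ball 0 r"
  shows "(\<lambda>s. (deriv ^^ k) (\<Phi> s) x) holomorphic_on S"
  using x
proof (induction k arbitrary: x)
  case 0
  then show ?case using par by simp
next
  case (Suc k)
  define e where "e = (r - norm x) / 2"
  have e: "e > 0" using Suc.prems by (simp add: e_def)
  have sub: "ball x (2 * e) \<subseteq> ball 0 r"
  proof
    fix y assume "y \<in> ball x (2 * e)"
    then show "y \<in> ball 0 r" using norm_triangle_ineq[of x "y - x"]
      by (simp add: e_def dist_norm norm_minus_commute)
  qed
  define B where "B = fact k * M / (e/2) ^ k"
  have hol': "(deriv ^^ k) (\<Phi> s) holomorphic_on ball 0 r" if "s \<in> S" for s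
    using hol[OF that] by (intro holomorphic_higher_deriv) auto
  have B: "cmod ((deriv ^^ k) (\<Phi> s) y) \<le> B" if s: "s \<in> S" and y: "y \<in> ball x e" for s y
    unfolding B_def
  proof (rule Cauchy_inequality)
    have "cball y (e/2) \<subseteq> ball x (2 * e)"
    proof
      fix w assume "w \<in> cball y (e/2)"
      then show "w \<in> ball x (2 * e)" using y e dist_triangle[of x w y] by simp
    qed
    then have sub': "cball y (e/2) \<subseteq> ball 0 r" using sub by blast
    show "\<Phi> s holomorphic_on ball y (e/2)"
      using hol[OF s] sub' ball_subset_cball holomorphic_on_subset by blast
    show "continuous_on (cball y (e/2)) (\<Phi> s)"
      using hol[OF s] sub' holomorphic_on_imp_continuous_on holomorphic_on_subset by blast
    show "0 < e/2" using e by simp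
    show "cmod (\<Phi> s w) \<le> M" if "cmod (y - w) = e/2" for w
    proof -
      have "w \<in> cball y (e/2)" using that by (simp add: dist_norm)
      then show ?thesis using bdd s sub' by blast
    qed
  qed
  define h where "h n = complex_of_real (e / (real n + 3))" for n
  have h: "h n \<noteq> 0" "cmod (h n) = e / (real n + 3)" "cmod (h n) < e / 2" for n
  proof -
    show n: "cmod (h n) = e / (real n + 3)" using e by (simp add: h_def norm_divide del: of_real_divide)
    show "h n \<noteq> 0" using e unfolding h_def of_real_eq_0_iff by simp
    show "cmod (h n) < e / 2" unfolding n using e by (intro divide_strict_left_mono) auto
  qed
  define g where "g n s = ((deriv ^^ k) (\<Phi> s) (x + h n) - (deriv ^^ k) (\<Phi> s) x) / h n" for n s
  have xh: "x + h n \<in> ball 0 r" for n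
  proof -
    have "x + h n \<in> ball x (2 * e)" using h(3)[of n] e by (simp add: dist_norm)
    then show ?thesis using sub by blast
  qed
  have "(\<lambda>s. (deriv ^^ Suc k) (\<Phi> s) x) holomorphic_on S"
  proof (rule holomorphic_uniform_sequence[OF S, where f = g])
    show "g n holomorphic_on S" for n
      unfolding g_def using h(1)
      by (intro holomorphic_on_divide holomorphic_on_diff Suc.IH xh Suc.prems holomorphic_on_const) auto
  next
    have est: "cmod (g n s - (deriv ^^ Suc k) (\<Phi> s) x) \<le> 32 * B / e\<^sup>2 * cmod (h n)" if s: "s \<in> S" for n s
    proof -
      have "cmod ((deriv ^^ k) (\<Phi> s) (x + h n) - (deriv ^^ k) (\<Phi> s) x
            - h n * deriv ((deriv ^^ k) (\<Phi> s)) x) \<le> 32 * B / e\<^sup>2 * (cmod (h n))\<^sup>2"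
      proof (rule first_order_Taylor_bound)
        have "ball x e \<subseteq> ball x (2 * e)" using e by (intro subset_ball) simp
        then show "(deriv ^^ k) (\<Phi> s) holomorphic_on ball x e"
          using hol'[OF s] sub holomorphic_on_subset by blast
      qed (use e B[OF s] h(3) in auto)
      moreover have "g n s - (deriv ^^ Suc k) (\<Phi> s) x = ((deriv ^^ k) (\<Phi> s) (x + h n) - (deriv ^^ k) (\<Phi> s) x
            - h n * deriv ((deriv ^^ k) (\<Phi> s)) x) / h n"
        using h(1)[of n] unfolding g_def by (simp add: diff_divide_distrib)
      moreover have "cmod (h n) > 0" using h(1) by simp
      ultimately show ?thesis
        by (simp add: norm_divide power2_eq_square pos_divide_le_eq mult.assoc)
    qed
    have lim: "(\<lambda>n. 32 * B / e\<^sup>2 * cmod (h n)) \<longlonglongrightarrow> 0"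
    proof -
      have "(\<lambda>n. e / (real n + 3)) \<longlonglongrightarrow> 0"
        by real_asymp
      then show ?thesis unfolding h(2) by (intro tendsto_mult_right_zero)
    qed
    have ul: "uniform_limit S g (\<lambda>s. (deriv ^^ Suc k) (\<Phi> s) x) sequentially"
    proof (rule uniform_limitI)
      fix \<epsilon> :: real assume "\<epsilon> > 0"
      then have "\<forall>\<^sub>F n in sequentially. 32 * B / e\<^sup>2 * cmod (h n) < \<epsilon>"
        using order_tendstoD(2)[OF lim] by blast
      then show "\<forall>\<^sub>F n in sequentially. \<forall>s\<in>S. dist (g n s) ((deriv ^^ Suc k) (\<Phi> s) x) < \<epsilon>"
      proof (rule eventually_mono)
        fix n assume n: "32 * B / e\<^sup>2 * cmod (h n) < \<epsilon>"
        show "\<forall>s\<in>S. dist (g n s) ((deriv ^^ Suc k) (\<Phi> s) x) < \<epsilon>"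
          unfolding dist_norm using est n by (blast intro: le_less_trans)
      qed
    qed
    fix s assume "s \<in> S"
    then obtain d where "d > 0" "cball s d \<subseteq> S" using S open_contains_cball by blast
    then show "\<exists>d>0. cball s d \<subseteq> S \<and> uniform_limit (cball s d) g (\<lambda>s. (deriv ^^ Suc k) (\<Phi> s) x) sequentially"
      using ul uniform_limit_on_subset by blast
  qed
  then show ?case .
qed

section \<open>Jensen bound on the unit circle\<close>

lemma integral_cis_shift:
  fixes h :: "complex \<Rightarrow> real"
  assumes h: "continuous_on (sphere 0 1) h" and \<phi>: "0 \<le> \<phi>" "\<phi> \<le> 2 * pi"
  shows "integral {\<phi>..\<phi> + 2 * pi} (\<lambda>t. h (cis t)) = integral {0..2 * pi} (\<lambda>t. h (cis t))"
proof -
  let ?g = "\<lambda>t. h (cis t)"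
  have cont: "continuous_on A ?g" for A
    by (rule continuous_on_compose2[OF h]) (auto intro!: continuous_intros)
  have int: "?g integrable_on {a..b}" for a b
    by (rule integrable_continuous_real[OF cont])
  have "integral {\<phi>..\<phi> + 2 * pi} ?g = integral {\<phi>..2 * pi} ?g + integral {2 * pi..\<phi> + 2 * pi} ?g"
    using Henstock_Kurzweil_Integration.integral_combine[of \<phi> "2 * pi" "\<phi> + 2 * pi" ?g] \<phi> int by simp
  also have "integral {2 * pi..\<phi> + 2 * pi} ?g = integral {0 + 2 * pi..\<phi> + 2 * pi} ?g" by simp
  also have "\<dots> = integral {0..\<phi>} (\<lambda>t. ?g (t + 2 * pi))"
    using integral_shift_Icc_real[of 0 \<phi> ?g "2 * pi"] by (simp add: o_def add.commute)
  also have "\<dots> = integral {0..\<phi>} ?g"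
    by (simp add: cis_mult[symmetric])
  finally show ?thesis
    using Henstock_Kurzweil_Integration.integral_combine[of 0 \<phi> "2 * pi" ?g] \<phi> int by simp
qed

text \<open>The starting angle \<open>\<phi>\<close> is arbitrary and \<open>N\<close> does not depend on it: the Riemann sums are to be
evaluated at the unknown point at which a product of rotated functions is largest.\<close>

lemma circle_Riemann_sum_upper_bound:
  fixes h :: "complex \<Rightarrow> real"
  assumes h: "continuous_on (sphere 0 1) h" and e: "e > 0"
  obtains N :: nat where "N > 0" and
    "\<And>\<phi>. 0 \<le> \<phi> \<Longrightarrow> \<phi> \<le> 2 * pi \<Longrightarrow> (\<Sum>j<N. h (cis (\<phi> + 2 * pi * real j / real N)))
       \<le> real N * (1 / (2 * pi) * integral {0..2 * pi} (\<lambda>t. h (cis t)) + e)"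
proof -
  let ?g = "\<lambda>t. h (cis t)"
  have cont: "continuous_on A ?g" for A
    by (rule continuous_on_compose2[OF h]) (auto intro!: continuous_intros)
  have int: "?g integrable_on {a..b}" for a b
    by (rule integrable_continuous_real[OF cont])
  \<comment> \<open>All points that occur lie between 0 and \<open>4 * pi\<close>: a starting angle and one full turn.\<close>
  have "uniformly_continuous_on (cbox 0 (4 * pi)) ?g"
    by (intro compact_uniformly_continuous cont) auto
  then obtain d where d: "d > 0" and
    close: "\<And>s t. s \<in> {0..4*pi} \<Longrightarrow> t \<in> {0..4*pi} \<Longrightarrow> dist t s < d \<Longrightarrow> dist (?g t) (?g s) < e"
    unfolding uniformly_continuous_on_def using e by (metis cbox_interval)
  obtain N :: nat where N': "2 * pi / d < real N" using reals_Archimedean2 by blast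
  have Npos: "real N > 0" using N' d by (intro le_less_trans[OF _ N']) simp
  have small: "2 * pi / real N < d" using N' d Npos by (simp add: field_simps)
  define p where "p \<phi> j = \<phi> + 2 * pi * real j / real N" for \<phi> j
  have pS: "p \<phi> (Suc j) = p \<phi> j + 2 * pi / real N" for \<phi> j
    by (simp add: p_def add_divide_distrib distrib_left)
  have pmono: "p \<phi> j \<le> p \<phi> (Suc j)" for \<phi> j using Npos unfolding pS by simp
  show ?thesis
  proof (rule that[of N])
    show "N > 0" using Npos by simp
    fix \<phi> :: real assume \<phi>: "0 \<le> \<phi>" "\<phi> \<le> 2 * pi"
    have p0: "\<phi> \<le> p \<phi> j" for j using Npos by (simp add: p_def)
    have piece: "2 * pi / real N * (?g (p \<phi> j) - e) \<le> integral {p \<phi> j..p \<phi> (Suc j)} ?g" if j: "j < N" for j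
    proof -
      have up: "p \<phi> (Suc j) \<le> 4 * pi"
      proof -
        have "2 * pi * real (Suc j) / real N \<le> 2 * pi"
          using j Npos by (simp add: divide_le_eq)
        then have "p \<phi> (Suc j) \<le> 2 * pi + 2 * pi" using \<phi> unfolding p_def by linarith
        then show ?thesis using pi_gt_zero by linarith
      qed
      have "integral {p \<phi> j..p \<phi> (Suc j)} (\<lambda>_. ?g (p \<phi> j) - e) \<le> integral {p \<phi> j..p \<phi> (Suc j)} ?g"
      proof (rule integral_le)
        fix t assume t: "t \<in> {p \<phi> j..p \<phi> (Suc j)}"
        have "dist t (p \<phi> j) < d" using t small by (simp add: dist_real_def pS)
        moreover have "t \<in> {0..4*pi}" "p \<phi> j \<in> {0..4*pi}"
          using t up p0[of j] \<phi> pmono[of \<phi> j] by auto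
        ultimately have "dist (?g t) (?g (p \<phi> j)) < e" by (intro close)
        then show "?g (p \<phi> j) - e \<le> ?g t" unfolding dist_real_def by linarith
      qed (auto intro: int)
      then show ?thesis using Npos by (simp add: pS content_real)
    qed
    have tele: "(\<Sum>j<n. integral {p \<phi> j..p \<phi> (Suc j)} ?g) = integral {\<phi>..p \<phi> n} ?g" for n
    proof (induction n)
      case 0 then show ?case by (simp add: p_def)
    next
      case (Suc n)
      then show ?case
        using Henstock_Kurzweil_Integration.integral_combine[of \<phi> "p \<phi> n" "p \<phi> (Suc n)" ?g] p0 pmono int by simp
    qed
    have "(\<Sum>j<N. 2 * pi / real N * (?g (p \<phi> j) - e)) \<le> integral {\<phi>..p \<phi> N} ?g"
      unfolding tele[symmetric] by (intro sum_mono piece) auto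
    also have "p \<phi> N = \<phi> + 2 * pi" using Npos by (simp add: p_def)
    also have "integral {\<phi>..\<phi> + 2 * pi} ?g = integral {0..2 * pi} ?g"
      by (rule integral_cis_shift[OF h \<phi>])
    finally have "2 * pi / real N * ((\<Sum>j<N. ?g (p \<phi> j)) - real N * e) \<le> integral {0..2 * pi} ?g"
      unfolding sum_distrib_left[symmetric] sum_subtractf by simp
    then have "(\<Sum>j<N. ?g (p \<phi> j)) - real N * e \<le> integral {0..2 * pi} ?g * (real N / (2 * pi))"
      using Npos by (simp add: field_simps)
    then show "(\<Sum>j<N. h (cis (\<phi> + 2 * pi * real j / real N)))
       \<le> real N * (1 / (2 * pi) * integral {0..2 * pi} (\<lambda>t. h (cis t)) + e)"
      by (simp add: p_def algebra_simps)
  qed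
qed

text \<open>This is the sub-mean value property of \<open>ln \<bar>f\<bar>\<close>, in a form that does not mention the zeros of
\<open>f\<close>. The product of the rotates of \<open>f\<close> by the \<open>N\<close>-th roots of unity takes the value \<open>f 0 ^ N\<close> at the
centre, and on the circle its size is bounded by the exponential of a Riemann sum of \<open>h\<close>. The
maximum principle compares the two, and the \<open>N\<close>-th root of the result tends to the claim.\<close>

lemma Jensen_circle_bound:
  assumes f: "f holomorphic_on cball 0 1"
    and h: "continuous_on (sphere 0 1) h" and M: "M \<ge> 0"
    and bound: "\<And>z. cmod z = 1 \<Longrightarrow> cmod (f z) \<le> M * exp (h z)"
  shows "cmod (f 0) \<le> M * exp (1 / (2 * pi) * integral {0..2 * pi} (\<lambda>t. h (cis t)))"
proof -
  define m where "m = 1 / (2 * pi) * integral {0..2 * pi} (\<lambda>t. h (cis t))"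
  have le: "cmod (f 0) \<le> M * exp (m + e)" if e: "e > 0" for e
  proof -
    obtain N :: nat where N: "N > 0" and sums: "\<And>\<phi>. 0 \<le> \<phi> \<Longrightarrow> \<phi> \<le> 2 * pi \<Longrightarrow>
        (\<Sum>j<N. h (cis (\<phi> + 2 * pi * real j / real N))) \<le> real N * (m + e)"
      using circle_Riemann_sum_upper_bound[OF h e] unfolding m_def by blast
    define P where "P z = (\<Prod>j<N. f (cis (2 * pi * real j / real N) * z))" for z
    have P: "P holomorphic_on cball 0 1"
      unfolding P_def
    proof (intro holomorphic_on_prod)
      fix j
      show "(\<lambda>z. f (cis (2 * pi * real j / real N) * z)) holomorphic_on cball 0 1"
        by (rule holomorphic_on_compose_gen[OF _ f, unfolded o_def])
          (auto intro!: holomorphic_intros simp: norm_mult)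
    qed
    have "cmod (P 0) \<le> (M * exp (m + e)) ^ N"
    proof (rule maximum_modulus_frontier[where S = "cball 0 1" and f = P])
      show "P holomorphic_on interior (cball 0 1)"
        using P holomorphic_on_subset interior_subset by blast
      show "continuous_on (closure (cball 0 1)) P"
        using P by (simp add: holomorphic_on_imp_continuous_on)
      fix z :: complex assume "z \<in> frontier (cball 0 1)"
      then have z: "cmod z = 1" by (simp add: frontier_def)
      define \<phi> where "\<phi> = Arg2pi z"
      have zc: "z = cis \<phi>" using z Arg2pi_eq[of z] by (simp add: \<phi>_def cis_conv_exp)
      have "cmod (P z) = (\<Prod>j<N. cmod (f (cis (\<phi> + 2 * pi * real j / real N))))"
        by (simp add: P_def prod_norm[symmetric] zc cis_mult add.commute)
      also have "\<dots> \<le> (\<Prod>j<N. M * exp (h (cis (\<phi> + 2 * pi * real j / real N))))"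
        by (intro prod_mono conjI bound) auto
      also have "\<dots> = M ^ N * exp (\<Sum>j<N. h (cis (\<phi> + 2 * pi * real j / real N)))"
        by (simp add: prod.distrib exp_sum)
      also have "\<dots> \<le> M ^ N * exp (real N * (m + e))"
      proof -
        have "0 \<le> \<phi>" "\<phi> \<le> 2 * pi"
          using Arg2pi_ge_0[of z] Arg2pi_lt_2pi[of z] by (simp_all add: \<phi>_def)
        from sums[OF this] show ?thesis using M by (intro mult_left_mono) auto
      qed
      also have "\<dots> = (M * exp (m + e)) ^ N"
        by (simp add: power_mult_distrib exp_of_nat_mult)
      finally show "cmod (P z) \<le> (M * exp (m + e)) ^ N" .
    qed auto
    then have "cmod (f 0) ^ N \<le> (M * exp (m + e)) ^ N"
      by (simp add: P_def norm_power)
    then show ?thesis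
      using M N by (simp add: power_mono_iff)
  qed
  have "eventually (\<lambda>e. cmod (f 0) \<le> M * exp (m + e)) (at_right 0)"
    using le by (intro eventually_at_rightI[of 0 1]) auto
  moreover have "((\<lambda>e. M * exp (m + e)) \<longlongrightarrow> M * exp (m + 0)) (at_right 0)"
    by (intro tendsto_intros)
  ultimately have "cmod (f 0) \<le> M * exp (m + 0)"
    by (intro tendsto_lowerbound[of "\<lambda>e. M * exp (m + e)"]) auto
  then show ?thesis by (simp add: m_def)
qed

section \<open>Extension to balls that reach over the boundary\<close>

text \<open>The homogeneous Taylor polynomial of degree \<open>k\<close> of \<open>u\<close> at \<open>z\<close>, evaluated at \<open>v\<close>.\<close>

definition line_coeff :: "(complex ^ 'n \<Rightarrow> complex) \<Rightarrow> complex ^ 'n \<Rightarrow> complex ^ 'n \<Rightarrow> nat \<Rightarrow> complex" where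
  "line_coeff u z v k = (deriv ^^ k) (\<lambda>\<xi>. u (z + \<xi> *s v)) 0 / fact k"

text \<open>The base point and the direction may vary together. Moving the base point (with \<open>d = 0\<close>) makes the
coefficients subject to the maximum principle on a disc; moving the direction (with \<open>b = 0\<close>) shows
that the sum of the Taylor series is holomorphic along lines.\<close>

lemma holomorphic_line_coeff:
  fixes u :: "complex ^ 'n \<Rightarrow> complex"
  assumes u: "holomorphic_Cn D u" and D: "open D"
  shows "(\<lambda>s. line_coeff u (a + s *s b) (c + s *s d) k) holomorphic_on {s. a + s *s b \<in> D}"
proof -
  let ?f = "\<lambda>s. line_coeff u (a + s *s b) (c + s *s d) k"
  have local: "\<exists>S. open S \<and> s \<in> S \<and> ?f holomorphic_on S" if s: "a + s *s b \<in> D" for s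
  proof -
    define p where "p = a + s *s b"
    obtain e where e: "e > 0" "cball p (2 * e) \<subseteq> D"
    proof -
      obtain e where "e > 0" "cball p e \<subseteq> D" using D s unfolding open_contains_cball p_def by blast
      then show ?thesis using that[of "e / 2"] by simp
    qed
    have "compact (u ` cball p (2 * e))"
      using holomorphic_Cn_continuous_on[OF u] e continuous_on_subset
      by (intro compact_continuous_image) auto
    then have "bounded (u ` cball p (2 * e))" by (rule compact_imp_bounded)
    then obtain M where M: "\<And>y. y \<in> cball p (2 * e) \<Longrightarrow> cmod (u y) \<le> M"
      unfolding bounded_iff by blast
    define N where "N = norm (c + s *s d) + 1"
    have N: "N > 0" unfolding N_def by (intro add_nonneg_pos) auto
    define S where "S = {s. a + s *s b \<in> ball p e} \<inter> {s. c + s *s d \<in> ball 0 N}"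
    have oS: "open S"
      unfolding S_def by (intro open_Int open_complex_line_preimage open_ball)
    have sS: "s \<in> S" using e by (simp add: S_def p_def N_def)
    have inb: "a + t *s b + \<xi> *s (c + t *s d) \<in> cball p (2 * e)" if "t \<in> S" "\<xi> \<in> ball 0 (e / N)" for t \<xi>
    proof -
      have "norm (\<xi> *s (c + t *s d)) \<le> (e / N) * N"
        unfolding norm_vector_scalar_mult using that e N by (intro mult_mono) (auto simp: S_def)
      then have 1: "norm (\<xi> *s (c + t *s d)) \<le> e" using N by simp
      have 2: "norm (a + t *s b - p) \<le> e" using that by (simp add: S_def dist_norm norm_minus_commute)
      have "norm ((a + t *s b - p) + \<xi> *s (c + t *s d)) \<le> e + e"
        by (rule norm_triangle_mono[OF 2 1])
      also have "(a + t *s b - p) + \<xi> *s (c + t *s d) = (a + t *s b + \<xi> *s (c + t *s d)) - p"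
        by simp
      finally have "dist p (a + t *s b + \<xi> *s (c + t *s d)) \<le> 2 * e"
        unfolding dist_norm norm_minus_commute[of p] by simp
      then show ?thesis unfolding mem_cball .
    qed
    have "(\<lambda>t. (deriv ^^ k) (\<lambda>\<xi>. u (a + t *s b + \<xi> *s (c + t *s d))) 0) holomorphic_on S"
    proof (rule holomorphic_higher_deriv_parameter[where r = "e / N" and M = M])
      fix t assume t: "t \<in> S"
      show "(\<lambda>\<xi>. u (a + t *s b + \<xi> *s (c + t *s d))) holomorphic_on ball 0 (e / N)"
        by (rule holomorphic_on_subset[OF holomorphic_Cn_line[OF u D]]) (use inb[OF t] e in blast)
      show "cmod (u (a + t *s b + \<xi> *s (c + t *s d))) \<le> M" if "\<xi> \<in> ball 0 (e / N)" for \<xi>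
        by (rule M[OF inb[OF t that]])
    next
      fix \<xi> :: complex assume x: "\<xi> \<in> ball 0 (e / N)"
      have eq: "a + t *s b + \<xi> *s (c + t *s d) = (a + \<xi> *s c) + t *s (b + \<xi> *s d)" for t
        by (simp add: vec_eq_iff algebra_simps)
      show "(\<lambda>t. u (a + t *s b + \<xi> *s (c + t *s d))) holomorphic_on S"
        unfolding eq
        by (rule holomorphic_on_subset[OF holomorphic_Cn_line[OF u D]]) (use inb[OF _ x, unfolded eq] e in blast)
    qed (use oS e N in auto)
    then have "?f holomorphic_on S"
      unfolding line_coeff_def by (intro holomorphic_on_divide) auto
    then show ?thesis using oS sS by blast
  qed
  have "?f field_differentiable (at s)" if "a + s *s b \<in> D" for s
    using local[OF that] holomorphic_on_imp_differentiable_at by blast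
  then show ?thesis
    unfolding holomorphic_on_def using field_differentiable_at_within by blast
qed

lemma line_coeff_bound:
  fixes u :: "complex ^ 'n \<Rightarrow> complex"
  assumes u: "holomorphic_Cn D u" and D: "open D" and r: "r > 0"
    and sub: "\<And>\<xi>. cmod \<xi> \<le> r \<Longrightarrow> p + \<xi> *s v \<in> D"
    and M: "\<And>\<xi>. cmod \<xi> = r \<Longrightarrow> cmod (u (p + \<xi> *s v)) \<le> M"
  shows "cmod (line_coeff u p v k) \<le> M / r ^ k"
proof -
  have hol: "(\<lambda>\<xi>. u (p + \<xi> *s v)) holomorphic_on cball 0 r"
    by (rule holomorphic_on_subset[OF holomorphic_Cn_line[OF u D]]) (use sub in auto)
  have "cmod ((deriv ^^ k) (\<lambda>\<xi>. u (p + \<xi> *s v)) 0) \<le> fact k * M / r ^ k"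
    by (rule Cauchy_inequality)
      (use hol r M ball_subset_cball holomorphic_on_subset in \<open>auto intro: holomorphic_on_imp_continuous_on\<close>)
  then show ?thesis by (simp add: line_coeff_def norm_divide field_simps)
qed

lemma line_coeff_sums:
  fixes u :: "complex ^ 'n \<Rightarrow> complex"
  assumes u: "holomorphic_Cn (ball z \<delta>) u" and x: "x \<in> ball z \<delta>"
  shows "line_coeff u z (x - z) sums u x"
proof -
  define v where "v = x - z"
  have v: "norm v < \<delta>" using x by (simp add: v_def dist_norm norm_minus_commute)
  have "\<delta> > 0" using v norm_ge_zero[of v] by linarith
  \<comment> \<open>A radius greater than 1 with \<open>r * norm v \<le> \<delta>\<close>, also when \<open>v = 0\<close>; the Taylor series in \<open>\<xi>\<close> is
     to be evaluated at \<open>\<xi> = 1\<close>.\<close>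
  define r where "r = 2 * \<delta> / (norm v + \<delta>)"
  have pos: "norm v + \<delta> > 0" using \<open>\<delta> > 0\<close> by (intro add_nonneg_pos) auto
  have r: "r > 1" using v pos by (simp add: r_def)
  have "r * norm v \<le> \<delta>"
  proof -
    have "2 * norm v * \<delta> \<le> (norm v + \<delta>) * \<delta>" using v \<open>\<delta> > 0\<close> by (intro mult_right_mono) auto
    then show ?thesis using pos by (simp add: r_def pos_divide_le_eq mult_ac)
  qed
  then have sub: "z + \<xi> *s v \<in> ball z \<delta>" if "\<xi> \<in> ball 0 r" for \<xi>
  proof (cases "v = 0")
    case False
    then have "cmod \<xi> * norm v < r * norm v" using that by (intro mult_strict_right_mono) auto
    then show ?thesis using \<open>r * norm v \<le> \<delta>\<close> by (simp add: dist_norm)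
  qed (use \<open>\<delta> > 0\<close> in simp)
  have "(\<lambda>\<xi>. u (z + \<xi> *s v)) holomorphic_on ball 0 r"
    by (rule holomorphic_on_subset[OF holomorphic_Cn_line[OF u open_ball]]) (use sub in auto)
  from holomorphic_power_series[OF this, of 1] r
  have "(\<lambda>k. line_coeff u z v k) sums u (z + 1 *s v)"
    by (simp add: line_coeff_def)
  then show ?thesis by (simp add: v_def)
qed

lemma ball_infdist_Compl_subset: "ball x (infdist x (- D)) \<subseteq> D"
proof
  fix y assume "y \<in> ball x (infdist x (- D))"
  then show "y \<in> D" using infdist_le[of y "- D" x] by (cases "y \<in> D") auto
qed

lemma infdist_Compl_pos:
  assumes "open D" "D \<noteq> UNIV" "x \<in> D" shows "infdist x (- D) > 0"
proof -
  have "- D \<noteq> {}" "closed (- D)" using assms by auto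
  then have "infdist x (- D) \<noteq> 0" using assms in_closed_iff_infdist_zero by blast
  then show ?thesis using infdist_nonneg[of x "- D"] by linarith
qed

lemma holomorphic_Cn_subset: "holomorphic_Cn D f \<Longrightarrow> D' \<subseteq> D \<Longrightarrow> holomorphic_Cn D' f"
  unfolding holomorphic_Cn_def by (blast intro: has_derivative_subset)

text \<open>The key step, a version of the Cartan-Thullen argument. On the boundary circle of the disc the
Cauchy inequalities bound the \<open>k\<close>-th coefficient of \<open>u\<close> by \<open>M\<close> times the \<open>k\<close>-th power of the reciprocal
of the boundary distance, up to a factor \<open>\<tau> < 1\<close> that keeps the points at which \<open>u\<close> is evaluated in
a compact subset \<open>L\<close> of \<open>D\<close>. Since the coefficient is holomorphic in the base point,
\<open>Jensen_circle_bound\<close> carries this bound to the centre, where the boundary distance is replaced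
by its geometric mean over the circle. So the Taylor series at \<open>z\<close> converges in the ball whose
radius is this geometric mean. The set \<open>L\<close> and the factor \<open>C\<close> serve all functions \<open>u\<close> at once.\<close>

lemma extension_to_mean_radius_ball:
  fixes z w :: "complex ^ 'n"
  assumes D: "open D" "D \<noteq> UNIV" and disc: "\<And>t. cmod t \<le> 1 \<Longrightarrow> z + t *s w \<in> D"
    and \<rho>: "0 < \<rho>" "\<rho> < exp (1 / (2 * pi) * integral {0..2 * pi} (\<lambda>\<theta>. ln (infdist (z + cis \<theta> *s w) (- D))))"
  obtains L C where "compact L" "L \<subseteq> D"
    "\<And>u M. holomorphic_Cn D u \<Longrightarrow> (\<And>x. x \<in> L \<Longrightarrow> cmod (u x) \<le> M) \<Longrightarrow>
       \<exists>F. holomorphic_Cn (ball z \<rho>) F \<and> (\<forall>x\<in>ball z \<rho>. cmod (F x) \<le> C * M) \<and>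
           (\<forall>x\<in>ball z \<rho> \<inter> ball z (infdist z (- D)). F x = u x)"
proof -
  define \<delta> where "\<delta> x = infdist x (- D)" for x
  define m where "m = 1 / (2 * pi) * integral {0..2 * pi} (\<lambda>\<theta>. ln (\<delta> (z + cis \<theta> *s w)))"
  have m: "\<rho> < exp m" using \<rho> by (simp add: m_def \<delta>_def)
  \<comment> \<open>Shrinking the radii by \<open>\<tau>\<close> makes \<open>L\<close> a subset of \<open>D\<close> and still leaves room for \<open>\<rho>\<close>.\<close>
  obtain \<tau> where \<tau>: "\<rho> / exp m < \<tau>" "\<tau> < 1"
    using dense[of "\<rho> / exp m" 1] m by auto
  have "0 < \<rho> / exp m" using \<rho> by simp
  then have \<tau>0: "0 < \<tau>" using \<tau> by linarith
  \<comment> \<open>The ratio of the geometric series that dominates the Taylor series; it is less than 1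
     because \<open>\<rho> / \<tau> < exp m\<close>.\<close>
  define q where "q = exp (ln (\<rho> / \<tau>) - m)"
  have q: "0 < q" "q < 1"
    using \<tau> \<tau>0 \<rho> by (simp_all add: q_def exp_diff field_simps)
  have \<delta>pos: "\<delta> (z + t *s w) > 0" if "cmod t \<le> 1" for t
    unfolding \<delta>_def by (rule infdist_Compl_pos[OF D disc[OF that]])
  have cont\<delta>: "continuous_on A (\<lambda>t. \<delta> (z + t *s w))" for A
    unfolding \<delta>_def
    by (intro continuous_on_infdist continuous_on_add continuous_on_const
        continuous_on_vector_scalar_mult_left continuous_on_id)
  \<comment> \<open>\<open>L\<close> is the union of the closed balls around the points of the circle with radius \<open>\<tau>\<close> times the
     boundary distance, written as a continuous image of a compact set.\<close>
  define \<Psi> where "\<Psi> = (\<lambda>(t, b). z + t *s w + (\<tau> * \<delta> (z + t *s w)) *\<^sub>R b)"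
  define L where "L = \<Psi> ` (sphere 0 1 \<times> cball 0 1)"
  have "continuous_on (sphere 0 1 \<times> cball 0 1) \<Psi>"
  proof -
    have "continuous_on (sphere 0 1 \<times> cball 0 1) (\<lambda>p. z + fst p *s w + (\<tau> * \<delta> (z + fst p *s w)) *\<^sub>R snd p)"
      unfolding \<delta>_def
      by (intro continuous_on_infdist continuous_on_add continuous_on_const continuous_on_scaleR
          continuous_on_mult continuous_on_vector_scalar_mult_left continuous_on_fst continuous_on_snd continuous_on_id)
    then show ?thesis by (simp add: \<Psi>_def case_prod_beta')
  qed
  then have Lc: "compact L" unfolding L_def
    by (intro compact_continuous_image compact_Times compact_sphere compact_cball)
  have LD: "L \<subseteq> D"
  proof
    fix x assume "x \<in> L"
    then obtain t b where t: "cmod t = 1" and b: "norm b \<le> 1" and x: "x = z + t *s w + (\<tau> * \<delta> (z + t *s w)) *\<^sub>R b"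
      by (auto simp: L_def \<Psi>_def)
    have dp: "\<delta> (z + t *s w) > 0" using \<delta>pos t by simp
    have "norm ((\<tau> * \<delta> (z + t *s w)) *\<^sub>R b) \<le> \<tau> * \<delta> (z + t *s w)"
      using \<tau>0 dp b by (simp add: abs_mult mult_left_le)
    also have "\<dots> < \<delta> (z + t *s w)" using \<tau> dp by simp
    finally have "x \<in> ball (z + t *s w) (\<delta> (z + t *s w))"
      by (simp add: x dist_norm)
    then show "x \<in> D" using ball_infdist_Compl_subset unfolding \<delta>_def by blast
  qed
  have zD: "z \<in> D" using disc[of 0] by simp
  have main: "\<exists>F. holomorphic_Cn (ball z \<rho>) F \<and> (\<forall>x\<in>ball z \<rho>. cmod (F x) \<le> 1 / (1 - q) * M) \<and>
           (\<forall>x\<in>ball z \<rho> \<inter> ball z (infdist z (- D)). F x = u x)"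
    if u: "holomorphic_Cn D u" and M: "\<And>x. x \<in> L \<Longrightarrow> cmod (u x) \<le> M" for u M
  proof -
    have "\<Psi> (1, 0) \<in> L" unfolding L_def by (intro imageI) auto
    then have M0: "M \<ge> 0" using M norm_ge_zero order_trans by blast
    have coeff: "cmod (line_coeff u z v k) \<le> M * q ^ k" if v: "norm v < \<rho>" for v k
    proof -
      \<comment> \<open>The logarithm of the Cauchy bound for the \<open>k\<close>-th coefficient, without the factor \<open>M\<close>.\<close>
      define h where "h t = real k * (ln (\<rho> / \<tau>) - ln (\<delta> (z + t *s w)))" for t
      have hol: "(\<lambda>t. line_coeff u (z + t *s w) v k) holomorphic_on cball 0 1"
      proof (rule holomorphic_on_subset)
        show "(\<lambda>t. line_coeff u (z + t *s w) v k) holomorphic_on {t. z + t *s w \<in> D}"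
          using holomorphic_line_coeff[OF u D(1), of z w v 0 k] by simp
      qed (use disc in auto)
      have lncont: "continuous_on A (\<lambda>t. ln (\<delta> (z + t *s w)))" if "\<And>t. t \<in> A \<Longrightarrow> cmod t \<le> 1" for A
        using that \<delta>pos by (intro continuous_on_ln cont\<delta>) fastforce
      have "cmod (line_coeff u (z + 0 *s w) v k) \<le> M * exp (1 / (2 * pi) * integral {0..2 * pi} (\<lambda>\<theta>. h (cis \<theta>)))"
      proof (rule Jensen_circle_bound[OF hol _ M0])
        show "continuous_on (sphere 0 1) h"
          unfolding h_def by (intro continuous_intros lncont) auto
        fix t :: complex assume t: "cmod t = 1"
        define p where "p = z + t *s w"
        have dp: "\<delta> p > 0" using \<delta>pos t by (simp add: p_def)
        define r where "r = \<tau> * \<delta> p / \<rho>"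
        have r: "r > 0" using dp \<tau>0 \<rho> by (simp add: r_def)
        have small: "norm (\<xi> *s v) \<le> \<tau> * \<delta> p" if "cmod \<xi> \<le> r" for \<xi>
        proof -
          have "cmod \<xi> * norm v \<le> r * \<rho>" using that v r by (intro mult_mono) auto
          then show ?thesis using \<rho> by (simp add: r_def)
        qed
        have "cmod (line_coeff u p v k) \<le> M / r ^ k"
        proof (rule line_coeff_bound[OF u D(1) r])
          fix \<xi>
          have *: "p + \<xi> *s v \<in> L" if \<xi>: "cmod \<xi> \<le> r"
          proof -
            define b where "b = (1 / (\<tau> * \<delta> p)) *\<^sub>R (\<xi> *s v)"
            have pos: "\<tau> * \<delta> p > 0" using \<tau>0 dp by simp
            then have "norm b \<le> 1" using small[OF \<xi>] by (simp add: b_def)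
            moreover have "p + \<xi> *s v = \<Psi> (t, b)"
              using \<tau>0 dp by (simp add: \<Psi>_def b_def p_def[symmetric])
            ultimately show ?thesis using t by (simp add: L_def)
          qed
          show "cmod \<xi> \<le> r \<Longrightarrow> p + \<xi> *s v \<in> D" using * LD by blast
          show "cmod \<xi> = r \<Longrightarrow> cmod (u (p + \<xi> *s v)) \<le> M" using * M by simp
        qed
        also have "M / r ^ k = M * exp (h t)"
        proof -
          have "exp (h t) = exp (ln (\<rho> / \<tau>) - ln (\<delta> p)) ^ k"
            by (simp add: h_def p_def exp_of_nat_mult)
          also have "exp (ln (\<rho> / \<tau>) - ln (\<delta> p)) = 1 / r"
            using dp \<tau>0 \<rho> by (simp add: exp_diff r_def)
          finally show ?thesis by (simp add: power_one_over)
        qed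
        finally show "cmod (line_coeff u (z + t *s w) v k) \<le> M * exp (h t)"
          by (simp add: p_def)
      qed
      also have "1 / (2 * pi) * integral {0..2 * pi} (\<lambda>\<theta>. h (cis \<theta>)) = real k * (ln (\<rho> / \<tau>) - m)"
      proof -
        have "continuous_on {0..2 * pi} (\<lambda>\<theta>. ln (\<delta> (z + cis \<theta> *s w)))"
          by (rule continuous_on_compose2[OF lncont[of "sphere 0 1"]]) (auto intro!: continuous_intros)
        then have int: "(\<lambda>\<theta>. ln (\<delta> (z + cis \<theta> *s w))) integrable_on {0..2 * pi}"
          by (rule integrable_continuous_real)
        have "integral {0..2 * pi} (\<lambda>\<theta>. h (cis \<theta>))
            = real k * (2 * pi * ln (\<rho> / \<tau>) - integral {0..2 * pi} (\<lambda>\<theta>. ln (\<delta> (z + cis \<theta> *s w))))"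
          unfolding h_def integral_mult_right
          using Henstock_Kurzweil_Integration.integral_diff[OF integrable_const_ivl int, of "ln (\<rho> / \<tau>)"] by simp
        then show ?thesis by (simp add: m_def field_simps)
      qed
      also have "exp (real k * (ln (\<rho> / \<tau>) - m)) = q ^ k"
        by (simp add: q_def exp_of_nat_mult)
      finally show ?thesis by simp
    qed
    have geo: "summable (\<lambda>k. M * q ^ k)" "(\<Sum>k. M * q ^ k) = 1 / (1 - q) * M"
      using q by (auto intro!: summable_mult summable_geometric simp: suminf_mult suminf_geometric summable_geometric)
    define F where "F x = (\<Sum>k. line_coeff u z (x - z) k)" for x
    have coeff': "cmod (line_coeff u z (x - z) k) \<le> M * q ^ k" if "x \<in> ball z \<rho>" for x k
      using that by (intro coeff) (simp add: dist_norm norm_minus_commute)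
    have F_bound: "cmod (F x) \<le> 1 / (1 - q) * M" if "x \<in> ball z \<rho>" for x
      unfolding F_def geo(2)[symmetric] using coeff'[OF that] geo(1) by (rule norm_suminf_le)
    have "holomorphic_on_lines (ball z \<rho>) F"
      unfolding holomorphic_on_lines_def
    proof (intro allI)
      fix p v
      define S where "S = {s. p + s *s v \<in> ball z \<rho>}"
      have oS: "open S" unfolding S_def by (intro open_complex_line_preimage open_ball)
      have ul: "uniform_limit S (\<lambda>n s. \<Sum>k<n. line_coeff u z (p + s *s v - z) k) (\<lambda>s. F (p + s *s v)) sequentially"
        unfolding F_def
      proof (rule Weierstrass_m_test[OF _ geo(1)])
        show "cmod (line_coeff u z (p + s *s v - z) k) \<le> M * q ^ k" if "s \<in> S" for k s
          using that by (intro coeff') (simp add: S_def)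
      qed
      have "(\<lambda>s. F (p + s *s v)) holomorphic_on S"
      proof (rule holomorphic_uniform_sequence[OF oS])
        fix n
        have "(\<lambda>s. line_coeff u z (p + s *s v - z) k) holomorphic_on S" for k
        proof (rule holomorphic_on_subset)
          show "(\<lambda>s. line_coeff u z (p + s *s v - z) k) holomorphic_on {s. z + s *s 0 \<in> D}"
            using holomorphic_line_coeff[OF u D(1), of z 0 "p - z" v k] by (simp add: algebra_simps)
        qed (use zD in auto)
        then show "(\<lambda>s. \<Sum>k<n. line_coeff u z (p + s *s v - z) k) holomorphic_on S"
          by (intro holomorphic_on_sum)
      next
        fix s assume "s \<in> S"
        then obtain d where "d > 0" "cball s d \<subseteq> S" using oS open_contains_cball by blast
        then show "\<exists>d>0. cball s d \<subseteq> S \<and> uniform_limit (cball s d)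
            (\<lambda>n s. \<Sum>k<n. line_coeff u z (p + s *s v - z) k) (\<lambda>s. F (p + s *s v)) sequentially"
          using ul uniform_limit_on_subset by blast
      qed
      then show "(\<lambda>s. F (p + s *s v)) holomorphic_on {s. p + s *s v \<in> ball z \<rho>}"
        by (simp add: S_def)
    qed
    then have "holomorphic_Cn (ball z \<rho>) F"
    proof (rule holomorphic_on_lines_imp_holomorphic_Cn[OF open_ball])
      fix x assume "x \<in> ball z \<rho>"
      then obtain r where "r > 0" "ball x r \<subseteq> ball z \<rho>"
        using open_ball open_contains_ball by blast
      then show "\<exists>r>0. \<exists>M. ball x r \<subseteq> ball z \<rho> \<and> (\<forall>y\<in>ball x r. cmod (F y) \<le> M)"
        using F_bound by blast
    qed
    moreover have "F x = u x" if "x \<in> ball z (infdist z (- D))" for x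
    proof -
      have "holomorphic_Cn (ball z (infdist z (- D))) u"
        by (rule holomorphic_Cn_subset[OF u ball_infdist_Compl_subset])
      from line_coeff_sums[OF this that] show ?thesis
        by (simp add: F_def sums_iff)
    qed
    ultimately show ?thesis using F_bound by blast
  qed
  show ?thesis
    by (rule that[OF Lc LD main])
qed

section \<open>Pointwise bounds for square-integrable holomorphic functions\<close>

lemma nn_integral_lborel_translate:
  fixes c :: "'a :: euclidean_space"
  assumes [measurable]: "f \<in> borel_measurable borel"
  shows "(\<integral>\<^sup>+x. f (c + x) \<partial>lborel) = (\<integral>\<^sup>+x. f x \<partial>lborel)"
  by (subst (2) lborel_distr_plus[of c, symmetric]) (simp add: nn_integral_distr)

lemma nn_integral_lborel_reflect:
  fixes c :: "'a :: euclidean_space"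
  assumes [measurable]: "f \<in> borel_measurable borel"
  shows "(\<integral>\<^sup>+x. f (c - x) \<partial>lborel) = (\<integral>\<^sup>+x. f x \<partial>lborel)"
  by (subst (2) lborel_affine[of "-1" c]) (simp_all add: density_1 nn_integral_distr one_ennreal_def[symmetric])

text \<open>Uniqueness of Haar measure in disguise: \<open>\<integral>\<integral> f (T x) * indicator B (T x + y) dy dx\<close> is evaluated
once directly and once after the translation of \<open>x\<close> that moves \<open>y\<close> from the second factor to the
first. This gives the two integrals of \<open>f\<close>, each times the volume of the unit ball \<open>B\<close>, which \<open>T\<close>
maps onto itself.\<close>

lemma nn_integral_lborel_isometry:
  fixes T :: "'a :: euclidean_space \<Rightarrow> 'a"
  assumes T: "linear T" "\<And>x. norm (T x) = norm x"
    and f [measurable]: "f \<in> borel_measurable borel"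
  shows "(\<integral>\<^sup>+x. f (T x) \<partial>lborel) = (\<integral>\<^sup>+x. f x \<partial>lborel)"
proof -
  have "inj T"
    using T by (simp add: linear_injective_0) (metis norm_eq_zero)
  then have "surj T" using T(1) by (simp add: linear_injective_imp_surjective)
  have contT: "continuous_on UNIV T" using T(1) by (simp add: linear_continuous_on linear_conv_bounded_linear)
  have [measurable]: "T \<in> borel_measurable borel"
    using contT by (rule borel_measurable_continuous_onI)
  define B where "B = ball (0 :: 'a) 1"
  have B[measurable]: "B \<in> sets borel" by (simp add: B_def)
  let ?I = "indicator B :: 'a \<Rightarrow> ennreal"
  let ?\<beta> = "emeasure lborel B"
  have "(\<integral>\<^sup>+x. f (T x) \<partial>lborel) * ?\<beta> = (\<integral>\<^sup>+x. \<integral>\<^sup>+y. f (T x) * ?I (T x + y) \<partial>lborel \<partial>lborel)"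
  proof -
    have "(\<integral>\<^sup>+y. f (T x) * ?I (T x + y) \<partial>lborel) = f (T x) * ?\<beta>" for x
      by (simp add: nn_integral_cmult nn_integral_lborel_translate)
    then show ?thesis by (simp add: nn_integral_multc)
  qed
  also have "\<dots> = (\<integral>\<^sup>+y. \<integral>\<^sup>+x. f (T x) * ?I (T x + y) \<partial>lborel \<partial>lborel)"
    by (rule lborel_pair.Fubini'[symmetric]) measurable
  also have "\<dots> = (\<integral>\<^sup>+y. \<integral>\<^sup>+x. f (T x - y) * ?I (T x) \<partial>lborel \<partial>lborel)"
  proof (rule nn_integral_cong)
    fix y
    obtain y' where y': "y = T y'" using \<open>surj T\<close> by (metis surjD)
    have *: "T (- y' + x) = T x - y" for x
      using T(1) by (simp add: linear_diff y')
    have "(\<integral>\<^sup>+x. f (T (- y' + x)) * ?I (T (- y' + x) + y) \<partial>lborel) = (\<integral>\<^sup>+x. f (T x) * ?I (T x + y) \<partial>lborel)"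
      by (rule nn_integral_lborel_translate) measurable
    then show "(\<integral>\<^sup>+x. f (T x) * ?I (T x + y) \<partial>lborel) = (\<integral>\<^sup>+x. f (T x - y) * ?I (T x) \<partial>lborel)"
      unfolding * by simp
  qed
  also have "\<dots> = (\<integral>\<^sup>+x. \<integral>\<^sup>+y. f (T x - y) * ?I (T x) \<partial>lborel \<partial>lborel)"
    by (rule lborel_pair.Fubini') measurable
  also have "\<dots> = (\<integral>\<^sup>+x. f x \<partial>lborel) * ?\<beta>"
  proof -
    have "(\<integral>\<^sup>+y. f (T x - y) * ?I (T x) \<partial>lborel) = (\<integral>\<^sup>+x. f x \<partial>lborel) * ?I (T x)" for x
      by (simp add: nn_integral_multc nn_integral_lborel_reflect)
    moreover have "?I (T x) = ?I x" for x
      by (simp add: B_def indicator_def T(2))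
    ultimately show ?thesis by (simp add: nn_integral_cmult)
  qed
  finally have "(\<integral>\<^sup>+x. f (T x) \<partial>lborel) * ?\<beta> = (\<integral>\<^sup>+x. f x \<partial>lborel) * ?\<beta>" .
  moreover have "?\<beta> = ennreal (measure lborel B)"
    using emeasure_lborel_ball_finite[of "0 :: 'a" 1] by (simp add: B_def emeasure_eq_ennreal_measure)
  moreover have "\<not> measure lborel B \<le> 0"
    unfolding B_def not_le by (rule content_ball_pos[OF zero_less_one])
  ultimately show ?thesis by (simp only: mult_right_ennreal_cancel simp_thms)
qed

lemma norm_le_circle_mean:
  assumes "f holomorphic_on cball 0 1"
  shows "cmod (f 0) \<le> integral {0..1} (\<lambda>t. cmod (f (circlepath 0 1 t)))"
proof -
  let ?g = "\<lambda>x. f (circlepath 0 1 x) / circlepath 0 1 x * vector_derivative (circlepath 0 1) (at x within {0..1})"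
  have "((\<lambda>u. f u / (u - 0)) has_contour_integral (2 * of_real pi * \<i> * f 0)) (circlepath 0 1)"
    by (rule Cauchy_integral_circlepath_simple[OF assms]) simp
  then have int: "(?g has_integral (2 * of_real pi * \<i> * f 0)) {0..1}"
    by (simp add: has_contour_integral_def)
  have cont: "continuous_on {0..1} (\<lambda>t. cmod (f (circlepath 0 1 t)))"
  proof (intro continuous_on_norm continuous_on_compose2[OF holomorphic_on_imp_continuous_on[OF assms]])
    show "continuous_on {0..1} (circlepath 0 1)" using path_circlepath[of 0 1] unfolding path_def .
    show "circlepath 0 1 ` {0..1} \<subseteq> cball 0 1"
      by (auto simp: circlepath)
  qed
  have "cmod (integral {0..1} ?g) \<le> integral {0..1} (\<lambda>t. 2 * pi * cmod (f (circlepath 0 1 t)))"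
  proof (rule integral_norm_bound_integral)
    show "?g integrable_on {0..1}" using int by (rule has_integral_integrable)
    show "(\<lambda>t. 2 * pi * cmod (f (circlepath 0 1 t))) integrable_on {0..1}"
      by (intro integrable_continuous_real continuous_on_mult continuous_on_const cont)
    show "cmod (?g t) \<le> 2 * pi * cmod (f (circlepath 0 1 t))" if "t \<in> {0..1}" for t
    proof -
      have "vector_derivative (circlepath 0 1) (at t within {0..1})
          = 2 * pi * \<i> * complex_of_real 1 * exp (2 * of_real pi * \<i> * t)"
        using that by (intro vector_derivative_circlepath01) auto
      moreover have "cmod (circlepath 0 1 t) = 1" by (simp add: circlepath)
      ultimately show ?thesis by (simp only: norm_mult norm_divide) simp
    qed
  qed
  then show ?thesis
    unfolding integral_unique[OF int] by (simp add: norm_mult)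
qed

text \<open>The square of \<open>u\<close> has the mean value property on the circle \<open>x + cis \<theta> *s y\<close> for each \<open>y\<close> in the ball.
Integrating over \<open>y\<close> and exchanging the integrals leaves, for each angle, the integral of
\<open>\<bar>u\<bar>\<^sup>2\<close> over the ball, since multiplication by \<open>cis \<theta>\<close> is an isometry.\<close>

lemma holomorphic_Cn_L2_mean_value:
  fixes u :: "complex ^ 'n \<Rightarrow> complex"
  assumes u: "holomorphic_Cn (ball x r) u" and r: "r > 0"
  shows "ennreal ((cmod (u x))\<^sup>2) * emeasure lborel (ball (0 :: complex ^ 'n) r)
    \<le> (\<integral>\<^sup>+y. ennreal (indicator (ball x r) y *\<^sub>R (cmod (u y))\<^sup>2) \<partial>lborel)"
proof -
  define v where "v y = indicator (ball x r) y *\<^sub>R (cmod (u y))\<^sup>2" for y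
  have v [measurable]: "v \<in> borel_measurable borel"
    unfolding v_def
    by (intro borel_measurable_continuous_on_indicator continuous_on_power continuous_on_norm
        holomorphic_Cn_continuous_on[OF u]) simp
  define G where "G y = ennreal (v (x + y))" for y
  have G [measurable]: "G \<in> borel_measurable borel" unfolding G_def by measurable
  let ?e = "circlepath 0 1"
  have ne: "cmod (?e t) = 1" for t by (simp add: circlepath)
  let ?J = "indicator {0..1} :: real \<Rightarrow> ennreal"
  let ?B = "ball (0 :: complex ^ 'n) r"
  have pointwise: "ennreal ((cmod (u x))\<^sup>2) * indicator ?B y \<le> (\<integral>\<^sup>+t. G (?e t *s y) * ?J t \<partial>lborel)" for y
  proof (cases "y \<in> ?B")
    case True
    \<comment> \<open>The square is holomorphic, so that its mean value property bounds \<open>\<bar>u\<bar>\<^sup>2\<close>.\<close>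
    define f where "f s = (u (x + s *s y))\<^sup>2" for s
    have mem: "x + s *s y \<in> ball x r" if "cmod s \<le> 1" for s
    proof -
      have "cmod s * norm y \<le> 1 * norm y" using that by (intro mult_right_mono) auto
      then show ?thesis using True by (simp add: dist_norm)
    qed
    have hol: "f holomorphic_on cball 0 1"
      unfolding f_def
      by (intro holomorphic_on_power holomorphic_on_subset[OF holomorphic_Cn_line[OF u open_ball]])
        (use mem in auto)
    have eq: "cmod (f (?e t)) = v (x + ?e t *s y)" for t
      using mem[of "?e t"] ne[of t] by (simp add: f_def v_def norm_power)
    have cont: "continuous_on {0..1} (\<lambda>t. cmod (f (?e t)))"
    proof (intro continuous_on_norm continuous_on_compose2[OF holomorphic_on_imp_continuous_on[OF hol]])
      show "continuous_on {0..1} ?e" using path_circlepath[of 0 1] unfolding path_def .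
      show "?e ` {0..1} \<subseteq> cball 0 1" using ne by auto
    qed
    have "(cmod (u x))\<^sup>2 \<le> integral {0..1} (\<lambda>t. cmod (f (?e t)))"
      using norm_le_circle_mean[OF hol] by (simp add: f_def norm_power)
    then have "ennreal ((cmod (u x))\<^sup>2) \<le> ennreal (integral {0..1} (\<lambda>t. cmod (f (?e t))))"
      by (rule ennreal_leI)
    also have "\<dots> = (\<integral>\<^sup>+t. ennreal (cmod (f (?e t))) * ?J t \<partial>lborel)"
      by (rule nn_integral_has_integral_lebesgue'[symmetric])
        (auto intro: integrable_integral integrable_continuous_real cont)
    also have "\<dots> = (\<integral>\<^sup>+t. G (?e t *s y) * ?J t \<partial>lborel)"
      by (simp add: eq G_def)
    finally show ?thesis using True by simp
  qed simp
  have [measurable]: "(\<lambda>p :: (complex ^ 'n) \<times> real. ?e (snd p) *s fst p) \<in> borel_measurable (borel \<Otimes>\<^sub>M borel)"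
  proof -
    have "continuous_on UNIV (\<lambda>p :: (complex ^ 'n) \<times> real. ?e (snd p) *s fst p)"
      unfolding circlepath vector_scalar_mult_def
      by (intro continuous_intros)
    then show ?thesis unfolding borel_prod by (rule borel_measurable_continuous_onI)
  qed
  have m: "(\<lambda>(y, t). G (?e t *s y) * ?J t) \<in> borel_measurable (lborel \<Otimes>\<^sub>M lborel)"
  proof -
    have "(\<lambda>p. G (?e (snd p) *s fst p) * ?J (snd p)) \<in> borel_measurable (borel \<Otimes>\<^sub>M borel)"
      by measurable
    then show ?thesis by (simp add: case_prod_beta' cong: measurable_cong_sets sets_pair_measure_cong)
  qed
  have "ennreal ((cmod (u x))\<^sup>2) * emeasure lborel ?B = (\<integral>\<^sup>+y. ennreal ((cmod (u x))\<^sup>2) * indicator ?B y \<partial>lborel)"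
    by (simp add: nn_integral_cmult_indicator)
  also have "\<dots> \<le> (\<integral>\<^sup>+y. \<integral>\<^sup>+t. G (?e t *s y) * ?J t \<partial>lborel \<partial>lborel)"
    by (intro nn_integral_mono pointwise)
  also have "\<dots> = (\<integral>\<^sup>+t. \<integral>\<^sup>+y. G (?e t *s y) * ?J t \<partial>lborel \<partial>lborel)"
    by (rule lborel_pair.Fubini'[OF m, symmetric])
  also have "\<dots> = (\<integral>\<^sup>+t. (\<integral>\<^sup>+y. G y \<partial>lborel) * ?J t \<partial>lborel)"
  proof (rule nn_integral_cong)
    fix t
    have lin: "linear (\<lambda>y :: complex ^ 'n. ?e t *s y)"
      by (rule linearI) (simp_all add: vec_eq_iff algebra_simps)
    have [measurable]: "(\<lambda>y :: complex ^ 'n. ?e t *s y) \<in> borel_measurable borel"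
      using lin by (intro borel_measurable_continuous_onI linear_continuous_on)
        (simp add: linear_conv_bounded_linear)
    have "(\<integral>\<^sup>+y. G (?e t *s y) * ?J t \<partial>lborel) = (\<integral>\<^sup>+y. G (?e t *s y) \<partial>lborel) * ?J t"
      by (rule nn_integral_multc) measurable
    also have "(\<integral>\<^sup>+y. G (?e t *s y) \<partial>lborel) = (\<integral>\<^sup>+y. G y \<partial>lborel)"
      by (rule nn_integral_lborel_isometry[OF lin _ G]) (simp add: ne)
    finally show "(\<integral>\<^sup>+y. G (?e t *s y) * ?J t \<partial>lborel) = (\<integral>\<^sup>+y. G y \<partial>lborel) * ?J t" .
  qed
  also have "\<dots> = (\<integral>\<^sup>+y. G y \<partial>lborel)"
    by (simp add: nn_integral_cmult_indicator)
  also have "\<dots> = (\<integral>\<^sup>+y. ennreal (v y) \<partial>lborel)"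
    unfolding G_def by (rule nn_integral_lborel_translate) measurable
  finally show ?thesis by (simp add: v_def)
qed

lemma set_nn_integral_eq_L2_norm:
  assumes "u \<in> L2h D"
  shows "(\<integral>\<^sup>+y. ennreal (indicator D y *\<^sub>R (cmod (u y))\<^sup>2) \<partial>lborel) = ennreal ((L2_norm_on D u)\<^sup>2)"
proof -
  have int: "integrable lebesgue (\<lambda>y. indicator D y *\<^sub>R (cmod (u y))\<^sup>2)"
    using assms by (simp add: L2h_def set_integrable_def)
  have "(\<integral>\<^sup>+y. ennreal (indicator D y *\<^sub>R (cmod (u y))\<^sup>2) \<partial>lborel)
      = (\<integral>\<^sup>+y. ennreal (indicator D y *\<^sub>R (cmod (u y))\<^sup>2) \<partial>lebesgue)"
    by (rule nn_integral_completion[symmetric])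
  also have "\<dots> = ennreal (integral\<^sup>L lebesgue (\<lambda>y. indicator D y *\<^sub>R (cmod (u y))\<^sup>2))"
    by (rule nn_integral_eq_integral[OF int]) auto
  also have "integral\<^sup>L lebesgue (\<lambda>y. indicator D y *\<^sub>R (cmod (u y))\<^sup>2) = (L2_norm_on D u)\<^sup>2"
  proof -
    have "0 \<le> integral\<^sup>L lebesgue (\<lambda>y. indicator D y *\<^sub>R (cmod (u y))\<^sup>2)"
      by (rule integral_nonneg_AE) auto
    then show ?thesis by (simp add: L2_norm_on_def set_lebesgue_integral_def)
  qed
  finally show ?thesis .
qed

text \<open>Balls of one fixed radius around the points of \<open>L\<close> lie in \<open>D\<close>, and the mean value inequality on
them has a constant independent of \<open>u\<close>. This bound turns statements about all holomorphic
functions into statements about the Bergman kernel.\<close>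

lemma L2h_unit_ball_bounded_on_compact:
  fixes D :: "(complex ^ 'n) set"
  assumes D: "open D" and L: "compact L" "L \<subseteq> D"
  obtains M where "\<And>u x. u \<in> L2h D \<Longrightarrow> L2_norm_on D u \<le> 1 \<Longrightarrow> x \<in> L \<Longrightarrow> cmod (u x) \<le> M"
proof -
  obtain r where r: "r > 0" "(\<Union>x\<in>L. ball x r) \<subseteq> D"
    using compact_subset_open_imp_ball_epsilon_subset[OF L(1) D L(2)] by blast
  define \<beta> where "\<beta> = measure lborel (ball (0 :: complex ^ 'n) r)"
  have \<beta>: "\<beta> > 0" "emeasure lborel (ball (0 :: complex ^ 'n) r) = ennreal \<beta>"
    using content_ball_pos[OF r(1)] emeasure_lborel_ball_finite[of "0 :: complex ^ 'n" r]
    by (auto simp: \<beta>_def emeasure_eq_ennreal_measure)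
  show ?thesis
  proof (rule that[of "sqrt (1 / \<beta>)"])
    fix u x assume u: "u \<in> L2h D" and norm: "L2_norm_on D u \<le> 1" and x: "x \<in> L"
    have sub: "ball x r \<subseteq> D" using r x by blast
    have "L2_norm_on D u \<ge> 0"
      unfolding L2_norm_on_def set_lebesgue_integral_def
      by (intro real_sqrt_ge_zero integral_nonneg_AE) auto
    then have n1: "(L2_norm_on D u)\<^sup>2 \<le> 1" using norm by (simp add: power_le_one)
    have "ennreal ((cmod (u x))\<^sup>2 * \<beta>) = ennreal ((cmod (u x))\<^sup>2) * emeasure lborel (ball (0 :: complex ^ 'n) r)"
      using \<beta> by (simp add: ennreal_mult)
    also have "\<dots> \<le> (\<integral>\<^sup>+y. ennreal (indicator (ball x r) y *\<^sub>R (cmod (u y))\<^sup>2) \<partial>lborel)"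
      using u sub r(1) by (intro holomorphic_Cn_L2_mean_value) (auto simp: L2h_def intro: holomorphic_Cn_subset)
    also have "\<dots> \<le> (\<integral>\<^sup>+y. ennreal (indicator D y *\<^sub>R (cmod (u y))\<^sup>2) \<partial>lborel)"
      using sub by (intro nn_integral_mono ennreal_leI) (auto simp: indicator_def)
    also have "\<dots> \<le> ennreal 1"
      unfolding set_nn_integral_eq_L2_norm[OF u] using n1 by (rule ennreal_leI)
    finally have "(cmod (u x))\<^sup>2 * \<beta> \<le> 1" by (simp add: ennreal_le_1)
    then have "(cmod (u x))\<^sup>2 \<le> 1 / \<beta>" using \<beta> by (simp add: field_simps)
    then show "cmod (u x) \<le> sqrt (1 / \<beta>)" by (rule real_le_rsqrt)
  qed
qed

section \<open>Gluing two domains along a part of their intersection\<close>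

text \<open>For open sets \<open>D\<close>, \<open>B\<close> and \<open>V\<close> with \<open>V \<subseteq> D \<inter> B\<close>, the points of \<open>D\<close> and \<open>B\<close> are identified over \<open>V\<close>
only. The tag 0 marks points of \<open>D\<close>, and 1 marks the points of \<open>B\<close> outside \<open>V\<close>; a point of
\<open>D \<inter> B\<close> outside \<open>V\<close> occurs with both tags. The topology is the final one for the two
inclusions.\<close>

definition glue_left :: "'a \<Rightarrow> 'a \<times> nat" where
  "glue_left p = (p, 0)"

definition glue_right :: "'a set \<Rightarrow> 'a \<Rightarrow> 'a \<times> nat" where
  "glue_right V p = (p, if p \<in> V then 0 else 1)"

lemma mem_glue_left_image: "y \<in> glue_left ` N \<longleftrightarrow> fst y \<in> N \<and> snd y = 0"
  by (cases y) (auto simp: glue_left_def)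

lemma mem_glue_right_image: "y \<in> glue_right V ` N \<longleftrightarrow> fst y \<in> N \<and> snd y = (if fst y \<in> V then 0 else 1)"
  by (cases y) (auto simp: glue_right_def)

definition glued_space :: "'a set \<Rightarrow> 'a set \<Rightarrow> 'a set \<Rightarrow> ('a :: topological_space \<times> nat) topology" where
  "glued_space D B V = topology (\<lambda>A. A \<subseteq> glue_left ` D \<union> glue_right V ` B \<and>
     open {p \<in> D. glue_left p \<in> A} \<and> open {p \<in> B. glue_right V p \<in> A})"

lemma openin_glued_space:
  "openin (glued_space D B V) A \<longleftrightarrow> A \<subseteq> glue_left ` D \<union> glue_right V ` B \<and>
     open {p \<in> D. glue_left p \<in> A} \<and> open {p \<in> B. glue_right V p \<in> A}"
proof -
  have "istopology (\<lambda>A. A \<subseteq> glue_left ` D \<union> glue_right V ` B \<and>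
     open {p \<in> D. glue_left p \<in> A} \<and> open {p \<in> B. glue_right V p \<in> A})" (is "istopology ?P")
    unfolding istopology_def
  proof (intro conjI allI impI)
    fix S T assume S: "?P S" and T: "?P T"
    have eq: "{p \<in> D. glue_left p \<in> S \<inter> T} = {p \<in> D. glue_left p \<in> S} \<inter> {p \<in> D. glue_left p \<in> T}"
      "{p \<in> B. glue_right V p \<in> S \<inter> T} = {p \<in> B. glue_right V p \<in> S} \<inter> {p \<in> B. glue_right V p \<in> T}"
      by auto
    show "open {p \<in> D. glue_left p \<in> S \<inter> T}" "open {p \<in> B. glue_right V p \<in> S \<inter> T}"
      unfolding eq using S T by (auto intro!: open_Int)
    show "S \<inter> T \<subseteq> glue_left ` D \<union> glue_right V ` B" using S by blast
  next
    fix K assume K: "\<forall>A\<in>K. ?P A"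
    have eq: "{p \<in> D. glue_left p \<in> \<Union>K} = (\<Union>A\<in>K. {p \<in> D. glue_left p \<in> A})"
      "{p \<in> B. glue_right V p \<in> \<Union>K} = (\<Union>A\<in>K. {p \<in> B. glue_right V p \<in> A})"
      by auto
    show "open {p \<in> D. glue_left p \<in> \<Union>K}" "open {p \<in> B. glue_right V p \<in> \<Union>K}"
      unfolding eq using K by (auto intro!: open_UN)
    show "\<Union>K \<subseteq> glue_left ` D \<union> glue_right V ` B" using K by blast
  qed
  then show ?thesis by (simp add: glued_space_def topology_inverse')
qed

context
  fixes D B V :: "'a :: t2_space set"
  assumes opens: "open D" "open B" "open V" and V: "V \<subseteq> D \<inter> B"
begin

lemma openin_glue_left: "open W \<Longrightarrow> W \<subseteq> D \<Longrightarrow> openin (glued_space D B V) (glue_left ` W)"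
proof -
  assume W: "open W" "W \<subseteq> D"
  then have "{p \<in> D. glue_left p \<in> glue_left ` W} = W" "{p \<in> B. glue_right V p \<in> glue_left ` W} = V \<inter> W"
    using V by (auto simp: glue_left_def glue_right_def split: if_splits)
  then show ?thesis using W opens by (auto simp: openin_glued_space)
qed

lemma openin_glue_right: "open W \<Longrightarrow> W \<subseteq> B \<Longrightarrow> openin (glued_space D B V) (glue_right V ` W)"
proof -
  assume W: "open W" "W \<subseteq> B"
  then have "{p \<in> B. glue_right V p \<in> glue_right V ` W} = W" "{p \<in> D. glue_left p \<in> glue_right V ` W} = V \<inter> W"
    using V by (auto simp: glue_left_def glue_right_def split: if_splits)
  then show ?thesis using W opens by (auto simp: openin_glued_space)
qed

lemma topspace_glued_space: "topspace (glued_space D B V) = glue_left ` D \<union> glue_right V ` B"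
proof
  show "topspace (glued_space D B V) \<subseteq> glue_left ` D \<union> glue_right V ` B"
    using openin_topspace[of "glued_space D B V"] unfolding openin_glued_space by blast
  show "glue_left ` D \<union> glue_right V ` B \<subseteq> topspace (glued_space D B V)"
    using openin_glue_left[OF opens(1)] openin_glue_right[OF opens(2)] by (simp add: openin_subset)
qed

lemma continuous_map_glued_fst: "continuous_map (glued_space D B V) euclidean fst"
  unfolding continuous_map_def
proof (intro conjI allI impI)
  fix W :: "'a set" assume "openin euclidean W"
  then have W: "open W" by simp
  have eq: "{p \<in> D. glue_left p \<in> {x \<in> topspace (glued_space D B V). fst x \<in> W}} = D \<inter> W"
    "{p \<in> B. glue_right V p \<in> {x \<in> topspace (glued_space D B V). fst x \<in> W}} = B \<inter> W"
    by (auto simp: topspace_glued_space glue_left_def glue_right_def)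
  show "openin (glued_space D B V) {x \<in> topspace (glued_space D B V). fst x \<in> W}"
    unfolding openin_glued_space eq using W opens topspace_glued_space by auto
qed auto

lemma continuous_map_glue_left: "continuous_map (top_of_set D) (glued_space D B V) glue_left"
  unfolding continuous_map_def
  using opens by (auto simp: openin_glued_space topspace_glued_space openin_open_eq)

lemma continuous_map_glue_right: "continuous_map (top_of_set B) (glued_space D B V) (glue_right V)"
  unfolding continuous_map_def
  using opens by (auto simp: openin_glued_space topspace_glued_space openin_open_eq)

text \<open>The only pairs of points that the projection does not separate lie over \<open>D \<inter> B - V\<close>, where the two
sheets are disjoint; for this the complement of \<open>V\<close> in \<open>D \<inter> B\<close> must be open.\<close>

lemma Hausdorff_glued_space:
  assumes rest: "open (D \<inter> B - V)"
  shows "Hausdorff_space (glued_space D B V)"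
  unfolding Hausdorff_space_def
proof (intro allI impI)
  fix x y
  assume xy: "x \<in> topspace (glued_space D B V) \<and> y \<in> topspace (glued_space D B V) \<and> x \<noteq> y"
  show "\<exists>U W. openin (glued_space D B V) U \<and> openin (glued_space D B V) W \<and> x \<in> U \<and> y \<in> W \<and> disjnt U W"
  proof (cases "fst x = fst y")
    case False
    then obtain U W where UW: "open U" "open W" "fst x \<in> U" "fst y \<in> W" "U \<inter> W = {}"
      using hausdorff[OF False] by blast
    let ?pre = "\<lambda>U. {x \<in> topspace (glued_space D B V). fst x \<in> U}"
    have "openin (glued_space D B V) (?pre U)" "openin (glued_space D B V) (?pre W)"
      using UW by (auto intro!: openin_continuous_map_preimage[OF continuous_map_glued_fst])
    moreover have "disjnt (?pre U) (?pre W)" using UW by (auto simp: disjnt_def)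
    ultimately show ?thesis using xy UW by blast
  next
    case True
    \<comment> \<open>Both points lie over the same point of \<open>D \<inter> B\<close> outside \<open>V\<close>, on different sheets.\<close>
    define N where "N = D \<inter> B - V"
    have N: "openin (glued_space D B V) (glue_left ` N)" "openin (glued_space D B V) (glue_right V ` N)"
      using rest by (auto simp: N_def intro!: openin_glue_left openin_glue_right)
    have dis: "disjnt (glue_left ` N) (glue_right V ` N)" "disjnt (glue_right V ` N) (glue_left ` N)"
      by (auto simp: disjnt_def N_def glue_left_def glue_right_def)
    have "(x \<in> glue_left ` N \<and> y \<in> glue_right V ` N) \<or> (y \<in> glue_left ` N \<and> x \<in> glue_right V ` N)"
      using xy True V unfolding topspace_glued_space N_def Un_iff mem_glue_left_image mem_glue_right_image prod_eq_iff
      by (auto split: if_splits)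
    then show ?thesis using N dis by blast
  qed
qed

lemma connected_glued_space:
  assumes "connected D" "connected B" "V \<noteq> {}"
  shows "connected_space (glued_space D B V)"
proof -
  have "connectedin (glued_space D B V) (glue_left ` D)"
    using connectedin_continuous_map_image[OF continuous_map_glue_left, of D] assms
    by (simp add: connectedin_subtopology)
  moreover have "connectedin (glued_space D B V) (glue_right V ` B)"
    using connectedin_continuous_map_image[OF continuous_map_glue_right, of B] assms
    by (simp add: connectedin_subtopology)
  moreover have "glue_left ` D \<inter> glue_right V ` B \<noteq> {}"
  proof -
    obtain p where p: "p \<in> V" using assms by blast
    then have "glue_left p = glue_right V p" by (simp add: glue_left_def glue_right_def)
    then show ?thesis using p V by blast
  qed
  ultimately have "connectedin (glued_space D B V) (topspace (glued_space D B V))"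
    unfolding topspace_glued_space by (rule connectedin_Un)
  then show ?thesis by (simp add: connectedin_topspace)
qed

end

text \<open>A continuous section of the projection with open image is inverse to the projection there.\<close>

lemma riemann_chart_of_section:
  fixes Y :: "((complex ^ 'n) \<times> nat) topology"
  assumes fst: "continuous_map Y euclidean fst" and U: "open U" and j: "\<And>p. fst (j p) = p"
    and jU: "openin Y (j ` U)" and cont: "\<And>A. openin Y A \<Longrightarrow> open {p \<in> U. j p \<in> A}"
  shows "riemann_chart Y fst (j ` U)" "fst ` j ` U = U"
proof -
  show im: "fst ` j ` U = U" using j by (auto simp: image_iff)
  have top: "topspace (subtopology Y (j ` U)) = j ` U"
    using openin_subset[OF jU] by auto
  have "homeomorphic_map (subtopology Y (j ` U)) (top_of_set U) fst"
  proof (rule bijective_open_imp_homeomorphic_map)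
    show "continuous_map (subtopology Y (j ` U)) (top_of_set U) fst"
      using fst im by (auto simp: continuous_map_in_subtopology continuous_map_from_subtopology top j)
    show "open_map (subtopology Y (j ` U)) (top_of_set U) fst"
      unfolding open_map_def
    proof (intro allI impI)
      fix A assume "openin (subtopology Y (j ` U)) A"
      then have A: "openin Y A" "A \<subseteq> j ` U" using jU by (auto simp: openin_open_subtopology)
      then have "fst ` A = {p \<in> U. j p \<in> A}" using j by (auto simp: image_iff) (metis j)
      then show "openin (top_of_set U) (fst ` A)" using cont[OF A(1)] U by (auto simp: openin_open_eq)
    qed
    show "fst ` topspace (subtopology Y (j ` U)) = topspace (top_of_set U)" unfolding top im by simp
    show "inj_on fst (topspace (subtopology Y (j ` U)))" unfolding top using j by (auto simp: inj_on_def)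
  qed
  then show "riemann_chart Y fst (j ` U)"
    unfolding riemann_chart_def im using jU U by blast
qed

lemma holomorphic_extension_glued_space:
  fixes D B V :: "(complex ^ 'n) set"
  assumes D: "open D" "connected D" and B: "open B" "connected B"
    and V: "open V" "V \<subseteq> D \<inter> B" "V \<noteq> {}" and rest: "open (D \<inter> B - V)"
    and ext: "\<And>u. holomorphic_Cn D u \<Longrightarrow> \<exists>F. holomorphic_Cn B F \<and> (\<forall>x\<in>V. F x = u x)"
  shows "holomorphic_extension D (glued_space D B V) fst glue_left"
proof -
  note ops = D(1) B(1) V(1,2)
  let ?Y = "glued_space D B V"
  have left: "riemann_chart ?Y fst (glue_left ` D)" "fst ` glue_left ` D = D"
    by (rule riemann_chart_of_section[OF continuous_map_glued_fst[OF ops] D(1) _ openin_glue_left[OF ops D(1) subset_refl]];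
        simp add: glue_left_def openin_glued_space)+
  have right: "riemann_chart ?Y fst (glue_right V ` B)" "fst ` glue_right V ` B = B"
    by (rule riemann_chart_of_section[OF continuous_map_glued_fst[OF ops] B(1) _ openin_glue_right[OF ops B(1) subset_refl]];
        simp add: glue_right_def openin_glued_space)+
  have "riemann_domain ?Y fst"
    unfolding riemann_domain_def
  proof (intro conjI ballI)
    show "connected_space ?Y" by (rule connected_glued_space[OF ops D(2) B(2) V(3)])
    show "Hausdorff_space ?Y" by (rule Hausdorff_glued_space[OF ops rest])
    fix x assume "x \<in> topspace ?Y"
    then show "\<exists>U. x \<in> U \<and> riemann_chart ?Y fst U"
      using left right unfolding topspace_glued_space[OF ops] by blast
  qed
  moreover have "riemann_morphism (top_of_set D) id ?Y fst glue_left"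
    using continuous_map_glue_left[OF ops] by (simp add: riemann_morphism_def glue_left_def)
  moreover have "\<exists>H. riemann_holomorphic ?Y fst H \<and> (\<forall>z\<in>D. H (glue_left z) = u z)"
    if u: "holomorphic_Cn D u" for u
  proof -
    obtain F where F: "holomorphic_Cn B F" "\<forall>x\<in>V. F x = u x" using ext[OF u] by blast
    define H where "H y = (if snd y = 0 \<and> fst y \<in> D then u (fst y) else F (fst y))" for y :: "(complex ^ 'n) \<times> nat"
    have HD: "H y = u (fst y)" if "y \<in> glue_left ` D" for y
      using that by (auto simp: H_def glue_left_def)
    have HB: "H y = F (fst y)" if "y \<in> glue_right V ` B" for y
      using that F V(2) by (auto simp: H_def glue_right_def split: if_splits)
    have "riemann_holomorphic ?Y fst H"
      unfolding riemann_holomorphic_def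
    proof
      fix x assume "x \<in> topspace ?Y"
      then consider "x \<in> glue_left ` D" | "x \<in> glue_right V ` B"
        unfolding topspace_glued_space[OF ops] by blast
      then show "\<exists>U g. x \<in> U \<and> riemann_chart ?Y fst U \<and> holomorphic_Cn (fst ` U) g \<and> (\<forall>y\<in>U. H y = g (fst y))"
      proof cases
        case 1
        then show ?thesis using left u HD by (intro exI[of _ "glue_left ` D"] exI[of _ u]) auto
      next
        case 2
        then show ?thesis using right F HB by (intro exI[of _ "glue_right V ` B"] exI[of _ F]) auto
      qed
    qed
    moreover have "\<forall>z\<in>D. H (glue_left z) = u z" using HD by (auto simp: glue_left_def)
    ultimately show ?thesis by blast
  qed
  ultimately show ?thesis unfolding holomorphic_extension_def by blast
qed

text \<open>The glued space is a Riemann domain to which all holomorphic functions on \<open>D\<close> extend, so it maps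
to \<open>E\<close> over \<open>\<complex>\<^sup>n\<close>; the image of its sheet \<open>B\<close> under this map can only be \<open>B\<close> itself.\<close>

lemma schlicht_envelope_contains_extension:
  fixes D E B V :: "(complex ^ 'n) set"
  assumes E: "schlicht_envelope D E"
    and D: "open D" "connected D" and B: "open B" "connected B"
    and V: "open V" "V \<subseteq> D \<inter> B" "V \<noteq> {}" and rest: "open (D \<inter> B - V)"
    and ext: "\<And>u. holomorphic_Cn D u \<Longrightarrow> \<exists>F. holomorphic_Cn B F \<and> (\<forall>x\<in>V. F x = u x)"
  shows "B \<subseteq> E"
proof
  fix x assume x: "x \<in> B"
  let ?Y = "glued_space D B V"
  have "holomorphic_extension D ?Y fst glue_left"
    by (rule holomorphic_extension_glued_space[OF D B V rest ext])
  then obtain \<phi> where \<phi>: "riemann_morphism ?Y fst (top_of_set E) id \<phi>"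
    using E unfolding schlicht_envelope_def envelope_of_holomorphy_def by blast
  have "glue_right V x \<in> topspace ?Y"
    using x unfolding topspace_glued_space[OF D(1) B(1) V(1,2)] by blast
  then have "\<phi> (glue_right V x) \<in> E" "\<phi> (glue_right V x) = fst (glue_right V x)"
    using \<phi> unfolding riemann_morphism_def by (auto simp: continuous_map_def Pi_iff)
  then show "x \<in> E" by (simp add: glue_right_def)
qed

lemma schlicht_envelope_extension:
  assumes E: "schlicht_envelope D E" and u: "holomorphic_Cn D u"
  obtains G where "holomorphic_Cn E G" "\<And>x. x \<in> D \<Longrightarrow> G x = u x"
proof -
  have "holomorphic_extension D (top_of_set E) id id" and oE: "open E"
    using E by (auto simp: schlicht_envelope_def envelope_of_holomorphy_def cdomain_def)
  then obtain G where G: "riemann_holomorphic (top_of_set E) id G" "\<And>x. x \<in> D \<Longrightarrow> G x = u x"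
    using u unfolding holomorphic_extension_def by (metis id_apply)
  have "holomorphic_Cn E G"
    unfolding holomorphic_Cn_def
  proof
    fix x assume x: "x \<in> E"
    then obtain U g where U: "x \<in> U" "riemann_chart (top_of_set E) id U" "holomorphic_Cn U g" "\<forall>y\<in>U. G y = g y"
      using G(1) unfolding riemann_holomorphic_def by (auto simp: image_id)
    have oU: "open U" using U(2) oE by (auto simp: riemann_chart_def)
    obtain f' where f': "(g has_derivative f') (at x within U)" "\<forall>c v. f' (c *s v) = c * f' v"
      using U unfolding holomorphic_Cn_def by blast
    have "(g has_derivative f') (at x)" using f'(1) at_within_open[OF U(1) oU] by simp
    then have "(G has_derivative f') (at x)"
      by (rule has_derivative_transform_within_open[OF _ oU U(1)]) (use U(4) in simp)
    then show "\<exists>f'. (G has_derivative f') (at x within E) \<and> (\<forall>c v. f' (c *s v) = c * f' v)"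
      using f'(2) has_derivative_at_withinI by blast
  qed
  then show ?thesis using that G(2) by blast
qed

section \<open>Smooth boundaries\<close>

text \<open>Near \<open>a\<close> the defining function increases in the direction \<open>n\<close> of its gradient at \<open>a\<close>. So each
point of \<open>D\<close> in a thin cylinder \<open>V\<close> with axis \<open>n\<close> is joined inside \<open>V \<inter> D\<close>, by a segment parallel to
\<open>n\<close>, to a small ball contained in \<open>D\<close> that is centred on the axis at \<open>c = a - (\<rho>/4) n\<close>.\<close>

lemma C1_smooth_imp_locally_connected_at_boundary:
  fixes D :: "(complex ^ 'n) set"
  assumes D: "open D" and C1: "C1_smooth D"
  shows "locally_connected_at_boundary D"
  unfolding locally_connected_at_boundary_def
proof (intro ballI allI impI)
  fix a U0 assume a: "a \<in> frontier D" and "open U0 \<and> a \<in> U0"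
  then have U0: "open U0" "a \<in> U0" by auto
  obtain U r g where chart: "open U \<and> a \<in> U \<and>
      (\<forall>x\<in>U. (r has_derivative (\<lambda>h. g x \<bullet> h)) (at x)) \<and> continuous_on U g \<and>
      (\<forall>x\<in>U. g x \<noteq> 0) \<and> D \<inter> U = {x \<in> U. r x < (0 :: real)}"
    using C1[unfolded C1_smooth_def, THEN bspec, OF a] by (elim exE) (rule that)
  then have U: "open U" "a \<in> U"
    and r: "\<And>x. x \<in> U \<Longrightarrow> (r has_derivative (\<lambda>h. g x \<bullet> h)) (at x)"
    and g: "continuous_on U g" "\<And>x. x \<in> U \<Longrightarrow> g x \<noteq> 0"
    and DU: "D \<inter> U = {x \<in> U. r x < 0}"
    by simp_all
  define n where "n = (1 / norm (g a)) *\<^sub>R g a"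
  have n: "norm n = 1" "g a \<bullet> n > 0"
    using g(2)[OF U(2)] by (simp_all add: n_def power2_norm_eq_inner[symmetric])
  have ra: "r a \<le> 0"
  proof (rule ccontr)
    assume "\<not> r a \<le> 0"
    moreover have "isCont r a" using r[OF U(2)] by (rule has_derivative_continuous)
    ultimately have "\<forall>\<^sub>F x in nhds a. r x > 0"
      unfolding isCont_def using U(2)
      by (metis tendsto_at_iff_tendsto_nhds not_le order_tendstoD(1))
    moreover have "\<forall>\<^sub>F x in nhds a. x \<in> U" using U by (rule eventually_nhds_in_open)
    ultimately have "\<forall>\<^sub>F x in nhds a. x \<notin> D"
    proof eventually_elim
      case (elim x)
      then have "x \<notin> D \<inter> U" unfolding DU by simp
      then show ?case using elim by blast
    qed
    then obtain S where S: "open S" "a \<in> S" "\<forall>x\<in>S. x \<notin> D" unfolding eventually_nhds by blast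
    have "a \<in> closure D" using a by (simp add: frontier_def)
    then show False using S by (meson closure_iff_nhds_not_empty disjoint_iff subset_refl)
  qed
  obtain \<rho> where \<rho>: "\<rho> > 0" "ball a \<rho> \<subseteq> U" "ball a \<rho> \<subseteq> U0" "\<And>x. x \<in> ball a \<rho> \<Longrightarrow> g x \<bullet> n > 0"
  proof -
    have "continuous (at a) g" using g(1) U continuous_on_eq_continuous_at by blast
    then have "((\<lambda>x. g x \<bullet> n) \<longlongrightarrow> g a \<bullet> n) (at a)"
      unfolding isCont_def by (intro tendsto_inner tendsto_const)
    then have "\<forall>\<^sub>F x in nhds a. g x \<bullet> n > 0"
      using n(2) by (metis tendsto_at_iff_tendsto_nhds order_tendstoD(1))
    moreover have "\<forall>\<^sub>F x in nhds a. x \<in> U" "\<forall>\<^sub>F x in nhds a. x \<in> U0"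
      using U U0 by (auto intro: eventually_nhds_in_open)
    ultimately have "\<forall>\<^sub>F x in nhds a. x \<in> U \<and> x \<in> U0 \<and> g x \<bullet> n > 0"
      by eventually_elim auto
    then obtain \<rho> where "\<rho> > 0" "\<And>x. dist x a < \<rho> \<Longrightarrow> x \<in> U \<and> x \<in> U0 \<and> g x \<bullet> n > 0"
      unfolding eventually_nhds_metric by blast
    then show ?thesis by (intro that[of \<rho>]) (auto simp: dist_commute)
  qed
  have deriv: "\<exists>y. ((\<lambda>\<sigma>. r (x + \<sigma> *\<^sub>R n)) has_real_derivative y) (at \<sigma>) \<and> 0 < y"
    if m: "x + \<sigma> *\<^sub>R n \<in> ball a \<rho>" for x \<sigma>
  proof -
    have "((\<lambda>\<sigma>. x + \<sigma> *\<^sub>R n) has_derivative (\<lambda>h. h *\<^sub>R n)) (at \<sigma>)"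
      by (auto intro!: derivative_eq_intros)
    moreover have "(r has_derivative (\<lambda>h. g (x + \<sigma> *\<^sub>R n) \<bullet> h)) (at (x + \<sigma> *\<^sub>R n))"
      using r m \<rho>(2) by blast
    ultimately have "((\<lambda>\<sigma>. r (x + \<sigma> *\<^sub>R n)) has_derivative (\<lambda>h. g (x + \<sigma> *\<^sub>R n) \<bullet> (h *\<^sub>R n))) (at \<sigma>)"
      by (rule has_derivative_compose)
    then have "((\<lambda>\<sigma>. r (x + \<sigma> *\<^sub>R n)) has_field_derivative g (x + \<sigma> *\<^sub>R n) \<bullet> n) (at \<sigma>)"
      by (simp add: has_field_derivative_def mult_commute_abs)
    then show ?thesis using \<rho>(4)[OF m] by blast
  qed
  have mono: "r (x + s *\<^sub>R n) \<le> r (x + t *\<^sub>R n)"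
    if st: "s \<le> t" and mem: "\<And>\<sigma>. s \<le> \<sigma> \<Longrightarrow> \<sigma> \<le> t \<Longrightarrow> x + \<sigma> *\<^sub>R n \<in> ball a \<rho>" for x s t
    by (rule DERIV_nonneg_imp_nondecreasing[OF st]) (use deriv[OF mem] in \<open>blast intro: less_imp_le\<close>)
  have strict: "r (a - (\<rho>/4) *\<^sub>R n) < r a"
  proof -
    have mem: "a + \<sigma> *\<^sub>R n \<in> ball a \<rho>" if "\<bar>\<sigma>\<bar> < \<rho>" for \<sigma>
      using that n by (simp add: dist_norm)
    have "r (a + (- (\<rho>/4)) *\<^sub>R n) < r (a + 0 *\<^sub>R n)"
    proof (rule DERIV_pos_imp_increasing[of "- (\<rho>/4)" 0 "\<lambda>\<sigma>. r (a + \<sigma> *\<^sub>R n)"])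
      fix \<sigma> :: real assume "- (\<rho>/4) \<le> \<sigma>" "\<sigma> \<le> 0"
      then have "\<bar>\<sigma>\<bar> < \<rho>" using \<rho>(1) by linarith
      from deriv[OF mem[OF this]]
      show "\<exists>y. ((\<lambda>\<sigma>. r (a + \<sigma> *\<^sub>R n)) has_real_derivative y) (at \<sigma>) \<and> 0 < y" .
    qed (use \<rho> in simp)
    then show ?thesis by simp
  qed
  define c where "c = a + (- (\<rho>/4)) *\<^sub>R n"
  have "c \<in> ball a \<rho>" using n \<rho> by (simp add: c_def dist_norm)
  moreover have "r c < 0" using strict ra by (simp add: c_def)
  ultimately have "c \<in> D" using DU \<rho>(2) by blast
  then obtain \<epsilon>0 where \<epsilon>0: "\<epsilon>0 > 0" "ball c \<epsilon>0 \<subseteq> D" using D unfolding open_contains_ball by blast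
  define \<epsilon> where "\<epsilon> = min \<epsilon>0 (\<rho>/2)"
  have \<epsilon>: "\<epsilon> > 0" "\<epsilon> \<le> \<rho>/2" "ball c \<epsilon> \<subseteq> D" using \<epsilon>0 \<rho> by (auto simp: \<epsilon>_def)
  \<comment> \<open>A cylinder rather than a ball around \<open>a\<close>: from points far from the axis, segments parallel
     to \<open>n\<close> would miss the small ball around \<open>c\<close>.\<close>
  define V where "V = (\<Union>s\<in>{- (\<rho>/2)<..<\<rho>/2}. ball (a + s *\<^sub>R n) \<epsilon>)"
  have cyl: "x + s *\<^sub>R n \<in> V" "x + s *\<^sub>R n \<in> ball a \<rho>" if "x \<in> ball a \<epsilon>" "\<bar>s\<bar> < \<rho>/2" for x s
  proof -
    have "x + s *\<^sub>R n \<in> ball (a + s *\<^sub>R n) \<epsilon>" using that by (simp add: dist_norm)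
    then show "x + s *\<^sub>R n \<in> V" unfolding V_def using that(2) by (intro UN_I[of s]) auto
    have "norm ((x - a) + s *\<^sub>R n) < \<rho>"
      using norm_triangle_ineq[of "x - a" "s *\<^sub>R n"] that \<epsilon>(2) n
      by (simp add: dist_norm norm_minus_commute)
    then show "x + s *\<^sub>R n \<in> ball a \<rho>" by (simp add: dist_norm norm_minus_commute algebra_simps)
  qed
  have decompose: "\<exists>x s. p = x + s *\<^sub>R n \<and> x \<in> ball a \<epsilon> \<and> \<bar>s\<bar> < \<rho>/2" if "p \<in> V" for p
  proof -
    obtain s where s: "- (\<rho>/2) < s" "s < \<rho>/2" "p \<in> ball (a + s *\<^sub>R n) \<epsilon>" using \<open>p \<in> V\<close> by (auto simp: V_def)
    have "p - s *\<^sub>R n \<in> ball a \<epsilon>" using s(3) by (simp add: dist_norm algebra_simps)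
    then show ?thesis using s by (intro exI[of _ "p - s *\<^sub>R n"] exI[of _ s]) auto
  qed
  have "open V" unfolding V_def by (intro open_UN ballI open_ball)
  moreover have "a \<in> V" using cyl(1)[of a 0] \<epsilon> \<rho> by simp
  moreover have "V \<subseteq> U0" using decompose cyl(2) \<rho>(3) by blast
  moreover have "connected (V \<inter> D)"
  proof -
    have bc: "ball c \<epsilon> \<subseteq> V \<inter> D"
    proof -
      have "ball c \<epsilon> \<subseteq> V" unfolding V_def c_def using \<rho>(1) by (intro UN_upper) auto
      then show ?thesis using \<epsilon>(3) by blast
    qed
    have to_c: "connected_component (V \<inter> D) p c" if p: "p \<in> V \<inter> D" for p
    proof -
      obtain x s where x: "p = x + s *\<^sub>R n" "x \<in> ball a \<epsilon>" "\<bar>s\<bar> < \<rho>/2" using decompose p by blast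
      \<comment> \<open>The foot of \<open>p\<close> in the small ball; \<open>p\<close> may lie on either side of it.\<close>
      define q where "q = x + (- (\<rho>/4)) *\<^sub>R n"
      have q: "q \<in> ball c \<epsilon>" using x(2) by (simp add: q_def c_def dist_norm)
      define T where "T = (\<lambda>t. x + t *\<^sub>R n) ` {min s (- (\<rho>/4))..max s (- (\<rho>/4))}"
      have "connected T" unfolding T_def
        by (intro connected_continuous_image continuous_intros connected_Icc)
      moreover have "T \<subseteq> V \<inter> D"
      proof
        fix y assume "y \<in> T"
        then obtain t where "y = x + t *\<^sub>R n" "t \<in> {min s (- (\<rho>/4))..max s (- (\<rho>/4))}"
          unfolding T_def by (rule imageE)
        then have t: "y = x + t *\<^sub>R n" "min s (- (\<rho>/4)) \<le> t" "t \<le> max s (- (\<rho>/4))"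
          unfolding atLeastAtMost_iff by blast+
        have small: "\<bar>\<sigma>\<bar> < \<rho>/2" if "min s (- (\<rho>/4)) \<le> \<sigma>" "\<sigma> \<le> max s (- (\<rho>/4))" for \<sigma>
          using that x(3) \<rho>(1) by linarith
        have "r y \<le> r (x + max s (- (\<rho>/4)) *\<^sub>R n)"
          unfolding t(1)
        proof (rule mono[OF t(3)])
          fix \<sigma> assume "t \<le> \<sigma>" "\<sigma> \<le> max s (- (\<rho>/4))"
          then have "\<bar>\<sigma>\<bar> < \<rho>/2" using t(2) by (intro small) linarith+
          then show "x + \<sigma> *\<^sub>R n \<in> ball a \<rho>" using x(2) by (intro cyl(2))
        qed
        also have "\<dots> < 0"
        proof -
          have "p \<in> D \<inter> U" "q \<in> D \<inter> U"
            using p q bc cyl(2)[OF x(2,3)] x(1) \<rho>(2) cyl(2)[OF x(2), of "- (\<rho>/4)"] \<rho>(1) by (auto simp: q_def)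
          then have "r p < 0" "r q < 0" unfolding DU by auto
          then show ?thesis by (simp add: max_def x(1) q_def)
        qed
        finally have "r y < 0" .
        moreover have "y \<in> U" "y \<in> V"
          using cyl[OF x(2) small[OF t(2,3)]] \<rho>(2) by (auto simp: t(1))
        ultimately show "y \<in> V \<inter> D" using DU by blast
      qed
      moreover have "p \<in> T" unfolding T_def x(1) by (intro imageI) auto
      moreover have "q \<in> T" unfolding T_def q_def by (intro imageI) auto
      ultimately have "connected_component (V \<inter> D) p q" unfolding connected_component_def by blast
      moreover have "connected_component (V \<inter> D) q c"
        unfolding connected_component_def using q bc \<epsilon>(1)
        by (intro exI[of _ "ball c \<epsilon>"]) auto
      ultimately show ?thesis by (rule connected_component_trans)
    qed
    show ?thesis
      unfolding connected_iff_connected_component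
      using to_c connected_component_sym connected_component_trans by metis
  qed
  ultimately show "\<exists>V. open V \<and> a \<in> V \<and> V \<subseteq> U0 \<and> connected (V \<inter> D)" by blast
qed

section \<open>The exhaustion function\<close>

text \<open>Opposite points of the circle average to \<open>z\<close>.\<close>

lemma norm_sub_mean_value:
  fixes z w :: "complex ^ 'n"
  shows "norm z \<le> 1 / (2 * pi) * integral {0..2 * pi} (\<lambda>\<theta>. norm (z + cis \<theta> *s w))"
proof -
  define h where "h c = norm (z + c *s w)" for c
  have h: "continuous_on A h" for A
    unfolding h_def by (intro continuous_intros)
  have cont: "continuous_on A (\<lambda>\<theta>. h (cis (\<theta> + \<phi>)))" for A \<phi>
    by (rule continuous_on_compose2[OF h[of UNIV]]) (auto intro!: continuous_intros)
  have int: "(\<lambda>\<theta>. h (cis (\<theta> + \<phi>))) integrable_on {0..2 * pi}" for \<phi>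
    by (rule integrable_continuous_real[OF cont])
  have le: "2 * norm z \<le> h (cis \<theta>) + h (cis (\<theta> + pi))" for \<theta>
  proof -
    have "norm ((z + cis \<theta> *s w) + (z + cis (\<theta> + pi) *s w)) \<le> h (cis \<theta>) + h (cis (\<theta> + pi))"
      unfolding h_def by (rule norm_triangle_ineq)
    also have "(z + cis \<theta> *s w) + (z + cis (\<theta> + pi) *s w) = 2 *\<^sub>R z"
      by (simp add: cis_mult[symmetric] vec_eq_iff scaleR_2)
    finally show ?thesis by simp
  qed
  have "integral {0..2 * pi} (\<lambda>_. 2 * norm z) \<le> integral {0..2 * pi} (\<lambda>\<theta>. h (cis \<theta>) + h (cis (\<theta> + pi)))"
    using int[of 0] int[of pi] le by (intro integral_le integrable_add) auto
  also have "\<dots> = integral {0..2 * pi} (\<lambda>\<theta>. h (cis \<theta>)) + integral {0..2 * pi} (\<lambda>\<theta>. h (cis (\<theta> + pi)))"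
    using int[of 0] int[of pi] by (intro Henstock_Kurzweil_Integration.integral_add) auto
  also have "integral {0..2 * pi} (\<lambda>\<theta>. h (cis (\<theta> + pi))) = integral {pi..pi + 2 * pi} (\<lambda>\<theta>. h (cis \<theta>))"
    using integral_shift_Icc_real[of 0 "2 * pi" "\<lambda>\<theta>. h (cis \<theta>)" pi] by (simp add: o_def add.commute)
  also have "\<dots> = integral {0..2 * pi} (\<lambda>\<theta>. h (cis \<theta>))"
    by (rule integral_cis_shift[OF h]) auto
  finally show ?thesis by (simp add: h_def field_simps)
qed

text \<open>The exhaustion function is the maximum of the norm, which keeps sublevel sets bounded, and the
negative logarithm of the boundary distance, which keeps them away from the boundary. For
\<open>D = UNIV\<close> the distance to the empty set and the logarithm of zero have the default value 0, so that
the second function vanishes.\<close>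

lemma pseudoconvex_if_neg_log_dist_sub_mean:
  fixes D :: "(complex ^ 'n) set"
  assumes D: "open D"
    and sub_mean: "\<And>z w. D \<noteq> UNIV \<Longrightarrow> (\<And>t. cmod t \<le> 1 \<Longrightarrow> z + t *s w \<in> D) \<Longrightarrow>
      - ln (infdist z (- D)) \<le> 1 / (2 * pi) * integral {0..2 * pi} (\<lambda>\<theta>. - ln (infdist (z + cis \<theta> *s w) (- D)))"
  shows "pseudoconvex D"
proof -
  define L where "L x = - ln (infdist x (- D))" for x
  define u where "u x = max (norm x) (L x)" for x
  have Lcont: "continuous_on D L"
  proof (cases "D = UNIV")
    case True
    then show ?thesis by (simp add: L_def infdist_def)
  next
    case False
    then show ?thesis unfolding L_def
      using infdist_Compl_pos[OF D False]
      by (intro continuous_intros continuous_on_infdist) force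
  qed
  have ucont: "continuous_on D u"
    unfolding u_def by (intro continuous_on_max Lcont continuous_intros)
  have Lmean: "L z \<le> 1 / (2 * pi) * integral {0..2 * pi} (\<lambda>\<theta>. L (z + cis \<theta> *s w))"
    if "\<And>t. cmod t \<le> 1 \<Longrightarrow> z + t *s w \<in> D" for z w
  proof (cases "D = UNIV")
    case True
    then show ?thesis by (simp add: L_def infdist_def)
  next
    case False
    then show ?thesis unfolding L_def using that by (rule sub_mean)
  qed
  have psh: "continuous_psh_on D u"
    unfolding continuous_psh_on_def
  proof (intro conjI allI impI ucont)
    fix z w assume disc: "\<forall>t. cmod t \<le> 1 \<longrightarrow> z + t *s w \<in> D"
    have circ: "continuous_on {0..2 * pi} (\<lambda>\<theta>. f (z + cis \<theta> *s w))" if "continuous_on D f" for f :: "_ \<Rightarrow> real"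
      by (rule continuous_on_compose2[OF that]) (use disc in \<open>auto intro!: continuous_intros\<close>)
    have le: "1 / (2 * pi) * integral {0..2 * pi} (\<lambda>\<theta>. f (z + cis \<theta> *s w))
        \<le> 1 / (2 * pi) * integral {0..2 * pi} (\<lambda>\<theta>. u (z + cis \<theta> *s w))"
      if "continuous_on D f" "\<And>x. f x \<le> u x" for f
      using that by (intro mult_left_mono integral_le integrable_continuous_real circ ucont) auto
    have "norm z \<le> 1 / (2 * pi) * integral {0..2 * pi} (\<lambda>\<theta>. u (z + cis \<theta> *s w))"
      by (rule order_trans[OF norm_sub_mean_value[of z w] le[of norm]])
        (auto simp: u_def intro!: continuous_intros)
    moreover have "L z \<le> 1 / (2 * pi) * integral {0..2 * pi} (\<lambda>\<theta>. u (z + cis \<theta> *s w))"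
      by (rule order_trans[OF Lmean[of z w] le[OF Lcont]]) (use disc in \<open>auto simp: u_def\<close>)
    ultimately show "u z \<le> 1 / (2 * pi) * integral {0..2 * pi} (\<lambda>\<theta>. u (z + cis \<theta> *s w))"
      by (simp add: u_def)
  qed
  have "compact (closure {z \<in> D. u z < c}) \<and> closure {z \<in> D. u z < c} \<subseteq> D" for c
  proof
    have "{z \<in> D. u z < c} \<subseteq> cball 0 c" by (auto simp: u_def)
    then have "bounded {z \<in> D. u z < c}" using bounded_cball bounded_subset by blast
    then show "compact (closure {z \<in> D. u z < c})" by (simp add: compact_closure)
    show "closure {z \<in> D. u z < c} \<subseteq> D"
    proof (cases "D = UNIV")
      case False
      have "closed {z. exp (- c) \<le> infdist z (- D)}"
        by (intro closed_Collect_le continuous_intros continuous_on_infdist)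
      moreover have "{z \<in> D. u z < c} \<subseteq> {z. exp (- c) \<le> infdist z (- D)}"
      proof safe
        fix z assume z: "z \<in> D" "u z < c"
        have "exp (- c) \<le> exp (ln (infdist z (- D)))" using z by (simp add: u_def L_def)
        then show "exp (- c) \<le> infdist z (- D)" using infdist_Compl_pos[OF D False z(1)] by simp
      qed
      ultimately have "closure {z \<in> D. u z < c} \<subseteq> {z. exp (- c) \<le> infdist z (- D)}"
        by (rule closure_minimal[rotated])
      also have "\<dots> \<subseteq> D"
      proof
        fix z assume "z \<in> {z. exp (- c) \<le> infdist z (- D)}"
        then have "infdist z (- D) > 0" using exp_gt_zero[of "- c"] by (simp del: exp_gt_zero)
        then show "z \<in> D" by (cases "z \<in> D") auto
      qed
      finally show ?thesis .
    qed simp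
  qed
  then show ?thesis unfolding pseudoconvex_def using D psh by blast
qed

section \<open>Boundary blow-up of the Bergman kernel\<close>

lemma bergman_kernel_Limsup_finite:
  assumes W: "open W" "a \<in> W"
    and bound: "\<And>u x. u \<in> L2h D \<Longrightarrow> L2_norm_on D u \<le> 1 \<Longrightarrow> x \<in> W \<inter> D \<Longrightarrow> cmod (u x) \<le> C"
  shows "Limsup (at a within D) (bergman_kernel D) \<noteq> \<infinity>"
proof -
  have le: "bergman_kernel D x \<le> ennreal (C\<^sup>2)" if "x \<in> W \<inter> D" for x
    unfolding bergman_kernel_def
  proof (rule SUP_least)
    fix u assume "u \<in> {u \<in> L2h D. L2_norm_on D u \<le> 1}"
    then show "ennreal ((cmod (u x))\<^sup>2) \<le> ennreal (C\<^sup>2)"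
      using bound that by (intro ennreal_leI power_mono) auto
  qed
  have "\<forall>\<^sub>F x in at a within D. bergman_kernel D x \<le> ennreal (C\<^sup>2)"
    unfolding eventually_at_topological using W le by blast
  then have "Limsup (at a within D) (bergman_kernel D) \<le> ennreal (C\<^sup>2)"
    by (rule Limsup_bounded)
  then show ?thesis by (auto simp: top_unique)
qed

text \<open>An extension \<open>F\<close> of \<open>u\<close> from \<open>A\<close> to \<open>B\<close> need not agree with \<open>u\<close> on other components of \<open>D \<inter> B\<close>. Near \<open>a\<close>
there are no other components: a connected piece \<open>W \<inter> D\<close> meets \<open>A\<close>, because \<open>a\<close> is in the closure of
\<open>A\<close>. The set \<open>W\<close> is the same for all functions.\<close>

lemma extension_agrees_if_locally_connected:
  fixes D :: "(complex ^ 'n) set"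
  assumes D: "open D" "locally_connected_at_boundary D" and a: "a \<in> frontier D" "a \<in> B" "a \<in> closure A"
    and AB: "open A" "A \<subseteq> D" "open B"
  obtains W where "open W" "a \<in> W" "W \<subseteq> B"
    "\<And>u F x. holomorphic_Cn D u \<Longrightarrow> holomorphic_Cn B F \<Longrightarrow> (\<And>x. x \<in> A \<Longrightarrow> F x = u x) \<Longrightarrow>
       x \<in> W \<inter> D \<Longrightarrow> F x = u x"
proof -
  obtain W where W: "open W" "a \<in> W" "W \<subseteq> B" "connected (W \<inter> D)"
    using D(2)[unfolded locally_connected_at_boundary_def, THEN bspec, OF a(1), THEN spec, of B] a(2) AB(3)
    by blast
  have "W \<inter> A \<noteq> {}"
    using a(3) W(1,2) open_Int_closure_eq_empty[OF W(1), of A] by blast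
  show ?thesis
  proof (rule that[OF W(1-3)])
    fix u F x assume u: "holomorphic_Cn D u" and F: "holomorphic_Cn B F"
      and eq: "\<And>x. x \<in> A \<Longrightarrow> F x = u x" and x: "x \<in> W \<inter> D"
    show "F x = u x"
    proof (rule identity_on_lines[of "W \<inter> D" F u "W \<inter> A"])
      show "holomorphic_on_lines (W \<inter> D) F"
        using W(3) by (intro holomorphic_on_lines_subset[OF holomorphic_Cn_imp_holomorphic_on_lines[OF F AB(3)]]) auto
      show "holomorphic_on_lines (W \<inter> D) u"
        by (intro holomorphic_on_lines_subset[OF holomorphic_Cn_imp_holomorphic_on_lines[OF u D(1)]]) auto
    qed (use W D(1) AB x eq \<open>W \<inter> A \<noteq> {}\<close> in auto)
  qed
qed

text \<open>Gluing \<open>B\<close> to \<open>D\<close> along the component of \<open>D \<inter> B\<close> that contains \<open>A\<close> shows \<open>B \<subseteq> E\<close>. Then the extension of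
\<open>u\<close> to \<open>E\<close> is a single function that agrees with \<open>F\<close> on \<open>B\<close> and with \<open>u\<close> on \<open>D\<close>.\<close>

lemma extension_agrees_if_schlicht:
  fixes D :: "(complex ^ 'n) set"
  assumes D: "open D" "connected D" and E: "schlicht_envelope D E"
    and B: "open B" "connected B" and A: "open A" "connected A" "A \<noteq> {}" "A \<subseteq> D \<inter> B"
    and ext: "\<And>u. holomorphic_Cn D u \<Longrightarrow> \<exists>F. holomorphic_Cn B F \<and> (\<forall>x\<in>A. F x = u x)"
    and u: "holomorphic_Cn D u" and F: "holomorphic_Cn B F" "\<And>x. x \<in> A \<Longrightarrow> F x = u x"
    and x: "x \<in> B \<inter> D"
  shows "F x = u x"
proof -
  obtain z where z: "z \<in> A" using A(3) by blast
  define V where "V = connected_component_set (D \<inter> B) z"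
  have V: "open V" "V \<subseteq> D \<inter> B" "connected V"
    using D(1) B(1) connected_component_subset[of "D \<inter> B" z] unfolding V_def
    by (simp_all add: open_connected_component open_Int)
  have AV: "A \<subseteq> V" unfolding V_def using A z by (intro connected_component_maximal) auto
  have rest: "open (D \<inter> B - V)"
  proof -
    have "openin (top_of_set (D \<inter> B)) (D \<inter> B - V)"
      unfolding V_def using closedin_connected_component[of "D \<inter> B" z] by (simp add: closedin_def)
    then show ?thesis using D(1) B(1) by (metis open_Int openin_open_eq)
  qed
  have extV: "\<exists>F. holomorphic_Cn B F \<and> (\<forall>x\<in>V. F x = u x)" if u: "holomorphic_Cn D u" for u
  proof -
    obtain F where F: "holomorphic_Cn B F" "\<forall>x\<in>A. F x = u x" using ext[OF u] by blast
    have "F x = u x" if "x \<in> V" for x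
    proof (rule identity_on_lines[OF V(1,3) _ _ A(1,3) AV _ that])
      show "holomorphic_on_lines V F" "holomorphic_on_lines V u"
        using V(2) F(1) u B(1) D(1)
        by (auto intro: holomorphic_on_lines_subset[OF holomorphic_Cn_imp_holomorphic_on_lines])
    qed (use F in auto)
    then show ?thesis using F by blast
  qed
  have "V \<noteq> {}" using AV A(3) by blast
  have BE: "B \<subseteq> E"
    by (rule schlicht_envelope_contains_extension[OF E D B V(1,2) \<open>V \<noteq> {}\<close> rest extV])
  obtain G where G: "holomorphic_Cn E G" "\<And>x. x \<in> D \<Longrightarrow> G x = u x"
    using schlicht_envelope_extension[OF E u] by blast
  have "open E" using E by (simp add: schlicht_envelope_def cdomain_def)
  have "F x = G x"
  proof (rule identity_on_lines[OF B _ _ A(1,3)])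
    show "holomorphic_on_lines B F" by (rule holomorphic_Cn_imp_holomorphic_on_lines[OF F(1) B(1)])
    show "holomorphic_on_lines B G"
      by (rule holomorphic_on_lines_subset[OF holomorphic_Cn_imp_holomorphic_on_lines[OF G(1) \<open>open E\<close>] BE])
  qed (use A F(2) G(2) x in auto)
  then show ?thesis using G(2) x by simp
qed

text \<open>If the inequality fails, the geometric mean of the boundary distance over the circle exceeds the
boundary distance \<open>d\<close> of the centre. Then all holomorphic functions on \<open>D\<close> extend from the ball \<open>A\<close>
of radius \<open>d\<close> to a larger concentric ball \<open>B\<close>, with uniform bounds on the unit ball of \<open>L2h D\<close>. The
boundary point \<open>a\<close> closest to the centre lies in \<open>B\<close>, and near it the extensions agree with the
original functions, so the Bergman kernel is bounded there.\<close>

lemma neg_log_dist_sub_mean_if_bergman_kernel_blows_up: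
  fixes D :: "(complex ^ 'n) set"
  assumes D: "open D" "connected D" "D \<noteq> UNIV"
    and blowup: "\<forall>a\<in>frontier D. Limsup (at a within D) (bergman_kernel D) = \<infinity>"
    and cond: "(\<exists>E. schlicht_envelope D E) \<or> locally_connected_at_boundary D"
    and disc: "\<And>t. cmod t \<le> 1 \<Longrightarrow> z + t *s w \<in> D"
  shows "- ln (infdist z (- D)) \<le> 1 / (2 * pi) * integral {0..2 * pi} (\<lambda>\<theta>. - ln (infdist (z + cis \<theta> *s w) (- D)))"
proof (rule ccontr)
  assume neg: "\<not> ?thesis"
  define m where "m = 1 / (2 * pi) * integral {0..2 * pi} (\<lambda>\<theta>. ln (infdist (z + cis \<theta> *s w) (- D)))"
  define d where "d = infdist z (- D)"
  have zD: "z \<in> D" using disc[of 0] by simp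
  have d: "d > 0" unfolding d_def by (rule infdist_Compl_pos[OF D(1,3) zD])
  have "ln d < m" using neg by (simp add: m_def d_def)
  then have "d < exp m" using d by (metis exp_less_cancel_iff exp_ln)
  then obtain \<rho> where \<rho>: "d < \<rho>" "\<rho> < exp m" using dense by blast
  have \<rho>0: "0 < \<rho>" using d \<rho> by linarith
  obtain L C where L: "compact L" "L \<subseteq> D" and
    ext: "\<And>u M. holomorphic_Cn D u \<Longrightarrow> (\<And>x. x \<in> L \<Longrightarrow> cmod (u x) \<le> M) \<Longrightarrow>
       \<exists>F. holomorphic_Cn (ball z \<rho>) F \<and> (\<forall>x\<in>ball z \<rho>. cmod (F x) \<le> C * M) \<and>
           (\<forall>x\<in>ball z \<rho> \<inter> ball z (infdist z (- D)). F x = u x)"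
    using extension_to_mean_radius_ball[OF D(1,3) disc \<rho>0 \<rho>(2)[unfolded m_def]] by blast
  define A where "A = ball z d"
  define B where "B = ball z \<rho>"
  have AB: "A \<subseteq> B" "B \<inter> ball z (infdist z (- D)) = A" and AD: "A \<subseteq> D"
    using \<rho> ball_infdist_Compl_subset[of z D] by (auto simp: A_def B_def d_def)
  have ext0: "\<exists>F. holomorphic_Cn B F \<and> (\<forall>x\<in>A. F x = u x)" if u: "holomorphic_Cn D u" for u
  proof -
    have "compact (u ` L)"
      using holomorphic_Cn_continuous_on[OF u] L continuous_on_subset by (intro compact_continuous_image) auto
    then have "bounded (u ` L)" by (rule compact_imp_bounded)
    then obtain M where M: "\<And>x. x \<in> L \<Longrightarrow> cmod (u x) \<le> M"
      unfolding bounded_iff by blast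
    from ext[OF u M] show ?thesis unfolding AB(2)[symmetric] B_def by blast
  qed
  have "closed (- D)" "- D \<noteq> {}" using D by auto
  then obtain a where a: "a \<in> - D" "d = dist z a"
    unfolding d_def by (rule infdist_attains_inf)
  have aB: "a \<in> B" using a \<rho> by (simp add: B_def)
  have aA: "a \<in> closure A" using a d by (simp add: A_def)
  have af: "a \<in> frontier D"
    using a(1) aA AD D(1) closure_mono[of A D] by (auto simp: frontier_def interior_open)
  obtain W where W: "open W" "a \<in> W" "W \<subseteq> B" and agree:
    "\<And>u F x. holomorphic_Cn D u \<Longrightarrow> holomorphic_Cn B F \<Longrightarrow> (\<And>x. x \<in> A \<Longrightarrow> F x = u x) \<Longrightarrow>
       x \<in> W \<inter> D \<Longrightarrow> F x = u x"
    using cond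
  proof
    assume "\<exists>E. schlicht_envelope D E"
    then obtain E where E: "schlicht_envelope D E" by blast
    have "F x = u x" if "holomorphic_Cn D u" "holomorphic_Cn B F" "\<And>x. x \<in> A \<Longrightarrow> F x = u x" "x \<in> B \<inter> D" for u F x
    proof (rule extension_agrees_if_schlicht[OF D(1,2) E, where A = A and B = B])
      show "open B" "connected B" "open A" "connected A" by (simp_all add: A_def B_def)
      show "A \<noteq> {}" using d by (simp add: A_def)
      show "A \<subseteq> D \<inter> B" using AB(1) AD by blast
    qed (use that ext0 in blast)+
    then show ?thesis using aB by (intro that[of B]) (auto simp: B_def)
  next
    assume lc: "locally_connected_at_boundary D"
    have "open A" "open B" by (simp_all add: A_def B_def)
    then obtain W where "open W" "a \<in> W" "W \<subseteq> B"
      "\<And>u F x. holomorphic_Cn D u \<Longrightarrow> holomorphic_Cn B F \<Longrightarrow> (\<And>x. x \<in> A \<Longrightarrow> F x = u x) \<Longrightarrow>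
         x \<in> W \<inter> D \<Longrightarrow> F x = u x"
      using extension_agrees_if_locally_connected[OF D(1) lc af aB aA _ AD] by blast
    then show ?thesis by (rule that)
  qed
  obtain M where M: "\<And>u x. u \<in> L2h D \<Longrightarrow> L2_norm_on D u \<le> 1 \<Longrightarrow> x \<in> L \<Longrightarrow> cmod (u x) \<le> M"
    using L2h_unit_ball_bounded_on_compact[OF D(1) L] by blast
  have "cmod (u x) \<le> C * M" if u: "u \<in> L2h D" "L2_norm_on D u \<le> 1" and x: "x \<in> W \<inter> D" for u x
  proof -
    have hol: "holomorphic_Cn D u" using u by (simp add: L2h_def)
    obtain F where F: "holomorphic_Cn B F" "\<forall>x\<in>B. cmod (F x) \<le> C * M" "\<forall>x\<in>A. F x = u x"
      using ext[OF hol M[OF u]] unfolding AB(2)[symmetric] B_def by blast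
    then have "F x = u x" using agree[OF hol F(1) _ x] by blast
    then show ?thesis using F(2) W(3) x by (metis IntD1 subsetD)
  qed
  then have "Limsup (at a within D) (bergman_kernel D) \<noteq> \<infinity>"
    by (rule bergman_kernel_Limsup_finite[OF W(1,2)])
  then show False using blowup af by blast
qed

theorem proposition6:
  fixes D :: "(complex ^ 'n) set"
  assumes "cdomain D"
  shows "((\<forall>a\<in>frontier D. Limsup (at a within D) (bergman_kernel D) = \<infinity>) \<and>
          ((\<exists>E. schlicht_envelope D E) \<or> locally_connected_at_boundary D) \<longrightarrow> pseudoconvex D)
       \<and> (C1_smooth D \<longrightarrow> locally_connected_at_boundary D)"
proof (intro conjI impI)
  have D: "open D" "connected D" using assms by (simp_all add: cdomain_def)
  show "locally_connected_at_boundary D" if "C1_smooth D"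
    by (rule C1_smooth_imp_locally_connected_at_boundary[OF D(1) that])
  assume "(\<forall>a\<in>frontier D. Limsup (at a within D) (bergman_kernel D) = \<infinity>) \<and>
      ((\<exists>E. schlicht_envelope D E) \<or> locally_connected_at_boundary D)"
  then have blowup: "\<forall>a\<in>frontier D. Limsup (at a within D) (bergman_kernel D) = \<infinity>"
    and cond: "(\<exists>E. schlicht_envelope D E) \<or> locally_connected_at_boundary D"
    by (rule conjunct1, rule conjunct2)
  show "pseudoconvex D"
    by (rule pseudoconvex_if_neg_log_dist_sub_mean[OF D(1)
        neg_log_dist_sub_mean_if_bergman_kernel_blows_up[OF D _ blowup cond]])
qed

end
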